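(* Let $q\ge3$ be a prime power, and let $d,n$ be positive integers satisfying $2\le d\le n\le q+1$. For every integer $c$ satisfying $\max\{0,2d-n-1\}\le c\le d-1$ and $(n,d,c)\notin\{(q+1,2,1),(q+1,q+1,q)\}$, with the additional restriction $(n,d,c)\ne(q+1,q/2+1,0)$ when $q$ is even, there exists a pure $[[n,\,n+c-2d+2,\,d;\,c]]_q$ (CSS-like) EAQLRC with locality $r=n-d+1$ that is optimal with respect to the Singleton-like bound, i.e. with $\kappa=n+c-2d+2$ and $\delta=d$ it satisfies $2\delta=n+c-\kappa-2\lceil\kappa/r\rceil+4$.
   Context: Notation. $[m]=\{1,\dots,m\}$. An $[n,k,d]_q$ linear code is a $k$-dimensional subspace of $\mathbb F_q^n$ with minimum distance $d$; $\mathcal C^\perp$ is the Euclidean dual; $\mathrm{supp}(\mathbf u)=\{i:u_i\neq0\}$; for a set $S\subseteq\mathbb F_q^n$ containing a nonzero vector, $\mathrm{wt}(S)$ is the minimum Hamming weight of its nonzero vectors. CSS-like EAQLRC with locality $r$. This is the code $\mathcal Q(\mathcal C_X,\mathcal C_Z)$ given by the EA-CSS construction (below) from an $[n,k_X,d_X]_q$ code $\mathcal C_X$ and an $[n,k_Z,d_Z]_q$ code $\mathcal C_Z$ satisfying: for every $i\in[n]$ there exist $\mathbf h_i^X\in\mathcal C_X^\perp$, $\mathbf h_i^Z\in\mathcal C_Z^\perp$ with $i\in\mathrm{supp}(\mathbf h_i^X)\cap\mathrm{supp}(\mathbf h_i^Z)$ and $|\mathrm{supp}(\mathbf h_i^X)\cup\mathrm{supp}(\mathbf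 h_i^Z)|\le r+1$. Its parameters $[[n,\kappa,\delta;c]]_q$ ($n$ transmitted qudits, $\kappa$ logical qudits, minimum distance $\delta$, $c$ maximally entangled pairs) are $$c=n-k_X-\dim(\mathcal C_X^\perp\cap\mathcal C_Z)=n-k_Z-\dim(\mathcal C_X\cap\mathcal C_Z^\perp),\qquad\kappa=k_X+k_Z-n+c,$$ and $\delta=\min\{d_X,d_Z\}$ if $\mathcal C_X\subseteq\mathcal C_Z^\perp$, and otherwise $\delta=\min\{\mathrm{wt}(\mathcal C_X\setminus(\mathcal C_X\cap\mathcal C_Z^\perp)),\ \mathrm{wt}(\mathcal C_Z\setminus(\mathcal C_X^\perp\cap\mathcal C_Z))\}$. It is pure if $\delta=\min\{d_X,d_Z\}$. EA-CSS construction. With $q=p^m$, qudit basis $\{|x\rangle:x\in\mathbb F_q\}$, $X(a)|x\rangle=|x+a\rangle$, $Z(b)|x\rangle=e^{2\pi i\,{\rm tr}(bx)/p}|x\rangle$ (${\rm tr}:\mathbb F_q\to\mathbb F_p$ the trace), tensor products $X_A(\mathbf a),Z_A(\mathbf b)$ on a register $A$, parity-check matrices $\mathbf H_X,\mathbf H_Z$ of $\mathcal C_X,\mathcal C_Z$, and a rank factorization $-\mathbf H_X\mathbf H_Z^\top=\mathbf F_X\mathbf F_Z^\top$ where $\mathbf F_X,\mathbf F_Z$ have $c=\mathrm{rank}(\mathbf H_X\mathbf H_Z^\top)$ columns, $\mathcal Q(\mathcal C_X,\mathcal C_Z)$ is the subspace of $\mathcal H_Q\otimes\mathcal H_B=(\mathbb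 C^q)^{\otimes n}\otimes(\mathbb C^q)^{\otimes c}$ (transmitted register $Q=(Q_1,\dots,Q_n)$, noiseless receiver register $B$) fixed by all operators $X_Q(\mathbf u\mathbf H_X)Z_Q(\mathbf v\mathbf H_Z)\otimes X_B(\mathbf u\mathbf F_X)Z_B(\mathbf v\mathbf F_Z)$, $\mathbf u\in\mathbb F_q^{n-k_X}$, $\mathbf v\in\mathbb F_q^{n-k_Z}$. Operational meaning of locality $r$. For every $i\in[n]$ there is $R_i\subseteq[n]\setminus\{i\}$ with $|R_i|\le r$ and a quantum channel (completely positive trace-preserving map) acting on the qudits $Q_{\{i\}\cup R_i}$ and $B$ which maps $\frac{I_{Q_i}}{q}\otimes{\rm Tr}_{Q_i}(|\psi\rangle\langle\psi|)$ back to $|\psi\rangle\langle\psi|$ for every unit vector $|\psi\rangle$ in the code; the paper shows that the support condition above implies this. *)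

theory Defs
  imports
    "HOL-Library.Cardinality"
    "HOL-Computational_Algebra.Computational_Algebra"
    "Jordan_Normal_Form.Matrix_Kernel"
    "Jordan_Normal_Form.DL_Rank"
begin

text \<open>
  The alphabet is a type of class \<open>{finite, field}\<close>, so that $q$ is its cardinality. Codes
  of length $n$ are sets of vectors in \<^term>\<open>carrier_vec n\<close>; coordinates are numbered
  from 0, so $[n]$ becomes \<open>{..<n}\<close>.
\<close>

section \<open>Linear codes\<close>

definition code_dim :: "nat \<Rightarrow> 'a::field vec set \<Rightarrow> nat" where
  "code_dim n C = vectorspace.dim class_ring ((module_vec TYPE('a) n)\<lparr>carrier := C\<rparr>)"

definition vec_supp :: "'a::zero vec \<Rightarrow> nat set" where
  "vec_supp v = {i. i < dim_vec v \<and> v $ i \<noteq> 0}"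

definition hamming_weight :: "'a::zero vec \<Rightarrow> nat" where
  "hamming_weight v = card (vec_supp v)"

definition hamming_dist :: "'a vec \<Rightarrow> 'a vec \<Rightarrow> nat" where
  "hamming_dist v w = card {i. i < dim_vec v \<and> v $ i \<noteq> w $ i}"

text \<open>Both minima below are taken in the natural numbers, where \<open>Inf {} = 0\<close>; hence a code
  without two distinct words and a set without nonzero vectors get the value 0.\<close>

definition min_dist :: "'a vec set \<Rightarrow> nat" where
  "min_dist C = Inf {hamming_dist v w | v w. v \<in> C \<and> w \<in> C \<and> v \<noteq> w}"

definition wt :: "'a::zero vec set \<Rightarrow> nat" where
  "wt S = Inf {hamming_weight v | v. v \<in> S \<and> v \<noteq> 0\<^sub>v (dim_vec v)}"

definition linear_code :: "nat \<Rightarrow> nat \<Rightarrow> nat \<Rightarrow> 'a::field vec set \<Rightarrow> bool" where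
  "linear_code n k d C \<longleftrightarrow>
     VectorSpace.subspace class_ring C (module_vec TYPE('a) n) \<and> code_dim n C = k \<and> min_dist C = d"

definition dual_code :: "nat \<Rightarrow> 'a::field vec set \<Rightarrow> 'a vec set" where
  "dual_code n C = {x \<in> carrier_vec n. \<forall>y\<in>C. x \<bullet> y = 0}"

definition parity_check_matrix :: "nat \<Rightarrow> 'a::field vec set \<Rightarrow> 'a mat \<Rightarrow> bool" where
  "parity_check_matrix n C H \<longleftrightarrow> H \<in> carrier_mat (n - code_dim n C) n \<and> mat_kernel H = C"

section \<open>Qudit registers\<close>

text \<open>The exponent $m$ with $q = p^m$.\<close>

definition field_degree :: "'a::{finite,field} itself \<Rightarrow> nat" where
  "field_degree _ = (THE m. CARD('a) = CHAR('a) ^ m)"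

definition field_trace :: "'a::{finite,field} \<Rightarrow> 'a" where
  "field_trace x = (\<Sum>j<field_degree TYPE('a). x ^ (CHAR('a) ^ j))"

text \<open>The trace lies in the prime field $\{0, 1, \dots, p-1\}$ of \<^typ>\<open>'a\<close>; in the exponent it
  is replaced by its representative in this range.\<close>

definition add_char :: "'a::{finite,field} \<Rightarrow> complex" where
  "add_char x = exp (2 * of_real pi * \<i> *
     of_nat (THE k. k < CHAR('a) \<and> of_nat k = field_trace x) / of_nat CHAR('a))"

text \<open>A pair \<open>(x, y)\<close> labels the basis state $|x\rangle_Q |y\rangle_B$ of $n$ transmitted and
  $c$ receiver qudits, and a function on such labels is the coefficient vector of a state.\<close>

type_synonym 'a label = "'a vec \<times> 'a vec"

definition labels :: "nat \<Rightarrow> nat \<Rightarrow> 'a label set" where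
  "labels n c = carrier_vec n \<times> carrier_vec c"

definition state_space :: "nat \<Rightarrow> nat \<Rightarrow> ('a label \<Rightarrow> complex) set" where
  "state_space n c = {\<psi>. \<forall>z. z \<notin> labels n c \<longrightarrow> \<psi> z = 0}"

definition unit_vector :: "nat \<Rightarrow> nat \<Rightarrow> ('a label \<Rightarrow> complex) \<Rightarrow> bool" where
  "unit_vector n c \<psi> \<longleftrightarrow> (\<Sum>z\<in>labels n c. (cmod (\<psi> z))\<^sup>2) = 1"

text \<open>$X_Q(a) \otimes X_B(a')$: since $|x\rangle |y\rangle \mapsto |x+a\rangle |y+a'\rangle$, the
  coefficient of $|x\rangle |y\rangle$ in the image is that of $|x-a\rangle |y-a'\rangle$.\<close>

definition X_op ::
  "nat \<Rightarrow> nat \<Rightarrow> 'a::field vec \<Rightarrow> 'a vec \<Rightarrow> ('a label \<Rightarrow> complex) \<Rightarrow> 'a label \<Rightarrow> complex" where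
  "X_op n c a a' \<psi> = (\<lambda>(x, y). if (x, y) \<in> labels n c then \<psi> (x - a, y - a') else 0)"

text \<open>$Z_Q(b) \otimes Z_B(b')$\<close>

definition Z_op ::
  "nat \<Rightarrow> nat \<Rightarrow> 'a::{finite,field} vec \<Rightarrow> 'a vec \<Rightarrow> ('a label \<Rightarrow> complex) \<Rightarrow> 'a label \<Rightarrow> complex" where
  "Z_op n c b b' \<psi> = (\<lambda>(x, y). (\<Prod>j<n. add_char (b $ j * x $ j)) *
     (\<Prod>j<c. add_char (b' $ j * y $ j)) * \<psi> (x, y))"

section \<open>The EA-CSS construction\<close>

text \<open>For a column vector \<open>u\<close>, the row vector $u H$ is \<open>H\<^sup>T *\<^sub>v u\<close>. The code depends
  on the choice of the four matrices, so it is described by a predicate.\<close>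

definition EA_CSS_code ::
  "nat \<Rightarrow> nat \<Rightarrow> 'a::{finite,field} vec set \<Rightarrow> 'a vec set \<Rightarrow> ('a label \<Rightarrow> complex) set \<Rightarrow> bool" where
  "EA_CSS_code n c C_X C_Z Q \<longleftrightarrow>
     (\<exists>H_X H_Z F_X F_Z.
        parity_check_matrix n C_X H_X \<and> parity_check_matrix n C_Z H_Z \<and>
        c = vec_space.rank (dim_row H_X) (H_X * H_Z\<^sup>T) \<and>
        F_X \<in> carrier_mat (dim_row H_X) c \<and> F_Z \<in> carrier_mat (dim_row H_Z) c \<and>
        - (H_X * H_Z\<^sup>T) = F_X * F_Z\<^sup>T \<and>
        Q = {\<psi> \<in> state_space n c.
               \<forall>u\<in>carrier_vec (dim_row H_X). \<forall>v\<in>carrier_vec (dim_row H_Z).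
                 X_op n c (H_X\<^sup>T *\<^sub>v u) (F_X\<^sup>T *\<^sub>v u)
                   (Z_op n c (H_Z\<^sup>T *\<^sub>v v) (F_Z\<^sup>T *\<^sub>v v) \<psi>) = \<psi>})"

definition EA_CSS_distance :: "nat \<Rightarrow> 'a::field vec set \<Rightarrow> 'a vec set \<Rightarrow> nat" where
  "EA_CSS_distance n C_X C_Z =
     (if C_X \<subseteq> dual_code n C_Z then min (min_dist C_X) (min_dist C_Z)
      else min (wt (C_X - (C_X \<inter> dual_code n C_Z))) (wt (C_Z - (dual_code n C_X \<inter> C_Z))))"

definition support_locality :: "nat \<Rightarrow> nat \<Rightarrow> 'a::field vec set \<Rightarrow> 'a vec set \<Rightarrow> bool" where
  "support_locality n r C_X C_Z \<longleftrightarrow>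
     (\<forall>i<n. \<exists>h_X\<in>dual_code n C_X. \<exists>h_Z\<in>dual_code n C_Z.
        i \<in> vec_supp h_X \<inter> vec_supp h_Z \<and> card (vec_supp h_X \<union> vec_supp h_Z) \<le> r + 1)"

text \<open>\<open>Q\<close> is a CSS-like $[[n,\kappa,\delta;c]]_q$ EAQLRC with locality \<open>r\<close>, built from
  \<open>C_X\<close> and \<open>C_Z\<close>.\<close>

definition CSS_EAQLRC ::
  "nat \<Rightarrow> nat \<Rightarrow> nat \<Rightarrow> nat \<Rightarrow> nat \<Rightarrow> 'a::{finite,field} vec set \<Rightarrow> 'a vec set
     \<Rightarrow> ('a label \<Rightarrow> complex) set \<Rightarrow> bool" where
  "CSS_EAQLRC n \<kappa> \<delta> c r C_X C_Z Q \<longleftrightarrow>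
     (\<exists>k_X d_X k_Z d_Z.
        linear_code n k_X d_X C_X \<and> linear_code n k_Z d_Z C_Z \<and>
        support_locality n r C_X C_Z \<and>
        EA_CSS_code n c C_X C_Z Q \<and>
        int c = int n - int k_X - int (code_dim n (dual_code n C_X \<inter> C_Z)) \<and>
        int c = int n - int k_Z - int (code_dim n (C_X \<inter> dual_code n C_Z)) \<and>
        int \<kappa> = int k_X + int k_Z - int n + int c \<and>
        \<delta> = EA_CSS_distance n C_X C_Z)"

definition pure_code :: "nat \<Rightarrow> 'a::field vec set \<Rightarrow> 'a vec set \<Rightarrow> bool" where
  "pure_code \<delta> C_X C_Z \<longleftrightarrow> \<delta> = min (min_dist C_X) (min_dist C_Z)"

definition singleton_optimal :: "nat \<Rightarrow> nat \<Rightarrow> nat \<Rightarrow> nat \<Rightarrow> nat \<Rightarrow> bool" where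
  "singleton_optimal n \<kappa> \<delta> c r \<longleftrightarrow>
     2 * int \<delta> = int n + int c - int \<kappa> - 2 * \<lceil>real \<kappa> / real r\<rceil> + 4"

section \<open>Recovery of an erased qudit\<close>

text \<open>Operators on $\mathbb{C}^A$, for a finite set \<open>A\<close> of basis labels, are matrices indexed
  by \<open>A\<close> and extended by zero.\<close>

type_synonym 'b opr = "'b \<Rightarrow> 'b \<Rightarrow> complex"

definition operators :: "'b set \<Rightarrow> 'b opr set" where
  "operators A = {M. \<forall>x y. (x, y) \<notin> A \<times> A \<longrightarrow> M x y = 0}"

definition positive_op :: "'b set \<Rightarrow> 'b opr \<Rightarrow> bool" where
  "positive_op A M \<longleftrightarrow>
     (\<forall>v. (\<Sum>x\<in>A. \<Sum>y\<in>A. cnj (v x) * M x y * v y) \<in> \<real> \<and>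
          0 \<le> Re (\<Sum>x\<in>A. \<Sum>y\<in>A. cnj (v x) * M x y * v y))"

text \<open>$\Phi \otimes \mathrm{id}$ applies $\Phi$ to each block of an operator on
  $\mathbb{C}^A \otimes \mathbb{C}^E$.\<close>

definition tensor_id :: "('b opr \<Rightarrow> 'b opr) \<Rightarrow> ('b \<times> 'e) opr \<Rightarrow> ('b \<times> 'e) opr" where
  "tensor_id \<Phi> M = (\<lambda>(x, e) (x', e'). \<Phi> (\<lambda>s s'. M (s, e) (s', e')) x x')"

definition quantum_channel :: "'b set \<Rightarrow> ('b opr \<Rightarrow> 'b opr) \<Rightarrow> bool" where
  "quantum_channel A \<Phi> \<longleftrightarrow>
     (\<forall>M\<in>operators A. \<Phi> M \<in> operators A) \<and>
     (\<forall>M\<in>operators A. \<forall>N\<in>operators A. \<forall>a.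
        \<Phi> (\<lambda>x y. a * M x y + N x y) = (\<lambda>x y. a * \<Phi> M x y + \<Phi> N x y)) \<and>
     (\<forall>M\<in>operators A. (\<Sum>x\<in>A. \<Phi> M x x) = (\<Sum>x\<in>A. M x x)) \<and>
     (\<forall>k::nat. \<forall>M\<in>operators (A \<times> {..<k}).
        positive_op (A \<times> {..<k}) M \<longrightarrow> positive_op (A \<times> {..<k}) (tensor_id \<Phi> M))"

text \<open>The basis states of the qudits \<open>S\<close> of $Q$ are labelled by the vectors of length $n$
  vanishing outside \<open>S\<close>, so that a label \<open>x\<close> of $Q$ is the sum of the labels
  \<open>mask S x\<close> of $Q_S$ and \<open>mask (- S) x\<close> of the remaining qudits.\<close>

definition mask :: "nat set \<Rightarrow> 'a::zero vec \<Rightarrow> 'a vec" where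
  "mask S x = vec (dim_vec x) (\<lambda>j. if j \<in> S then x $ j else 0)"

definition local_labels :: "nat \<Rightarrow> nat \<Rightarrow> nat set \<Rightarrow> 'a::zero label set" where
  "local_labels n c S = {(x, y) \<in> labels n c. mask S x = x}"

text \<open>A map on operators of the qudits $Q_S$ and $B$, tensored with the identity on the
  remaining qudits of $Q$.\<close>

definition apply_locally ::
  "nat \<Rightarrow> nat \<Rightarrow> nat set \<Rightarrow> ('a::field label opr \<Rightarrow> 'a label opr) \<Rightarrow> 'a label opr \<Rightarrow> 'a label opr" where
  "apply_locally n c S \<Phi> M = (\<lambda>(x, y) (x', y').
     \<Phi> (\<lambda>(s, t) (s', t').
          if (s, t) \<in> local_labels n c S \<and> (s', t') \<in> local_labels n c S
          then M (s + mask (- S) x, t) (s' + mask (- S) x', t') else 0)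
       (mask S x, y) (mask S x', y'))"

definition ket_bra :: "('b \<Rightarrow> complex) \<Rightarrow> 'b opr" where
  "ket_bra \<psi> = (\<lambda>x y. \<psi> x * cnj (\<psi> y))"

text \<open>$\frac{I_{Q_i}}{q} \otimes \mathrm{Tr}_{Q_i}(M)$\<close>

definition erase_qudit :: "nat \<Rightarrow> 'a::{finite,field} label opr \<Rightarrow> 'a label opr" where
  "erase_qudit i M = (\<lambda>(x, y) (x', y').
     if x $ i = x' $ i
     then (\<Sum>a\<in>UNIV. M (update_vec x i a, y) (update_vec x' i a, y')) / of_nat CARD('a)
     else 0)"

definition locally_recoverable ::
  "nat \<Rightarrow> nat \<Rightarrow> nat \<Rightarrow> ('a::{finite,field} label \<Rightarrow> complex) set \<Rightarrow> bool" where
  "locally_recoverable n c r Q \<longleftrightarrow>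
     (\<forall>i<n. \<exists>R \<subseteq> {..<n} - {i}. card R \<le> r \<and>
        (\<exists>\<Phi>. quantum_channel (local_labels n c (insert i R)) \<Phi> \<and>
           (\<forall>\<psi>\<in>Q. unit_vector n c \<psi> \<longrightarrow>
              (\<forall>z\<in>labels n c. \<forall>z'\<in>labels n c.
                 apply_locally n c (insert i R) \<Phi> (erase_qudit i (ket_bra \<psi>)) z z' =
                 ket_bra \<psi> z z'))))"

end

theory Submission
  imports Defs "HOL-Number_Theory.Cong"
begin

text \<open>
  Codes. Put $a = d - 1$, $k = n - a$ and $l = a - c$. If \<open>A\<close> and \<open>B\<close> are MDS codes of
  dimensions \<open>a\<close> and \<open>k\<close> with $\dim(A \cap B) = l$, then $C_X = A^\perp$ and $C_Z = B$ have all
  the required parameters: both are MDS of dimension \<open>k\<close>, every set of $k + 1$ coordinates is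
  the support of a word of each dual code, and the words of weight \<open>d\<close> span an MDS
  code, so that they do not all lie in a proper subspace. For \<open>A\<close> and \<open>B\<close> take (extended)
  Reed-Solomon codes, \<open>A\<close> multiplied coordinatewise by nonzero scalars. One choice of the scalars gives an
  intersection of dimension at least \<open>l\<close>, another one the trivial intersection, and changing
  one scalar changes the dimension by at most one.

  Recovery. The erased state is a uniform mixture of $X_i(a) Z_i(b) |\psi\rangle$ over all
  \<open>a\<close>, \<open>b\<close>. The powers of the two stabilizers with local supports containing \<open>i\<close> distinguish
  these errors, and the channel corrects the error according to the syndrome.
\<close>

text \<open>The parameters become conditions on \<open>l\<close>: since \<open>c = a - l\<close> and
  \<kappa> = \<open>k - l\<close>, the bounds on \<open>c\<close> say
  \<open>0 \<le> l \<le> a\<close> and \<open>l < k\<close>. Hence 0 < \<kappa> \<le>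
  \<open>k\<close>, the rounded quotient in the Singleton-like bound is 1, and optimality is
  arithmetic. The tight case is \<open>l = a\<close> at length \<open>q + 1\<close>, where a
  rescaled \<open>A\<close> must lie inside \<open>B\<close>. For Reed-Solomon codes this is done by
  a multiplier polynomial of degree \<open>k - a\<close> that vanishes at no point, infinity
  included. Such a polynomial exists in every degree other than 1, and degree 1 at this length means
  \<open>q + 1 = 2 * a + 1\<close>, which is the triple excluded for even \<open>q\<close>. The
  trivial intersection does not come from a generic choice of scalars, which would ask for a large
  field: the scalars are made nonzero one at a time, and each step rules out at most one value, so
  \<open>q \<ge> 3\<close> suffices. Dimensions are mostly compared as exponents of
  \<open>q\<close>, by counting. The additive character has two uses: it defines the Z operators,
  and its sums over a code give the duality theory.\<close>

no_notation fps_nth (infixl "$" 75)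

section \<open>The additive character of a finite field\<close>

lemma prime_CHAR: "prime CHAR('a::{finite,field})"
  using prime_CHAR_semidom[where ?'a = 'a] finite_imp_CHAR_pos[where ?'a = 'a] by simp

lemma power_card_eq_same:
  fixes x :: "'a::{finite,field}"
  shows "x ^ CARD('a) = x"
proof (cases "x = 0")
  case False
  have card: "CARD('a) > 0"
    by simp
  have "x ^ (CARD('a) - 1) * \<Prod>(UNIV - {0}) = (\<Prod>y\<in>UNIV - {0}. x * y)"
    by (simp add: prod.distrib)
  also have "\<dots> = \<Prod>(UNIV - {0})"
    by (rule prod.reindex_bij_witness[of _ "\<lambda>y. y / x" "\<lambda>y. x * y"]) (use False in auto)
  finally have "x ^ (CARD('a) - 1) = 1"
    by simp
  then have "x ^ Suc (CARD('a) - 1) = x"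
    by (simp only: power_Suc mult_1_right)
  with card show ?thesis
    by (metis Suc_diff_1)
qed simp

text \<open>Take an additively closed \<open>H\<close> of largest p-power size. An element
  \<open>x\<close> outside it yields the translates of \<open>H\<close> by
  \<open>0, x, ..., (p - 1) x\<close>, which are disjoint and together form a closed set
  \<open>p\<close> times as large. Closure under addition is enough, since \<open>- h\<close> is
  \<open>p - 1\<close> times \<open>h\<close>.\<close>

lemma card_eq_CHAR_power: "\<exists>m. CARD('a::{finite,field}) = CHAR('a) ^ m"
proof -
  let ?p = "CHAR('a)"
  define subgp where "subgp H \<longleftrightarrow> 0 \<in> H \<and> (\<forall>x\<in>H. \<forall>y\<in>H. x + y \<in> H)" for H :: "'a set"
  define good where "good H \<longleftrightarrow> subgp H \<and> (\<exists>k. card H = ?p ^ k)" for H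
  have p: "prime ?p"
    by (rule prime_CHAR)
  have "good {0}"
    by (auto simp: good_def subgp_def intro: exI[of _ 0])
  then obtain H where H: "good H" and maxH: "\<And>K. good K \<Longrightarrow> card K \<le> card H"
    using ex_has_greatest_nat[of good "{0}" card "Suc CARD('a)"]
    by (metis card_mono finite subset_UNIV less_Suc_eq_le)
  then obtain k where k: "card H = ?p ^ k" and H0: "0 \<in> H"
    and Hadd: "\<And>x y. x \<in> H \<Longrightarrow> y \<in> H \<Longrightarrow> x + y \<in> H"
    by (auto simp: good_def subgp_def)
  have Hmult: "of_nat j * x \<in> H" if "x \<in> H" for j x
    by (induction j) (use that H0 Hadd in \<open>auto simp: algebra_simps\<close>)
  have "H = UNIV"
  proof (rule ccontr)
    assume "H \<noteq> UNIV"
    then obtain x where x: "x \<notin> H"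
      by auto
    \<comment> \<open>\<open>j\<close> is invertible modulo \<open>p\<close>, so a suitable multiple
      of \<open>j x\<close> is \<open>x\<close> itself.\<close>
    have not_mult: "of_nat j * x \<notin> H" if j: "0 < j" "j < ?p" for j
    proof
      assume *: "of_nat j * x \<in> H"
      have "coprime j ?p"
        using p j by (metis coprime_commute nat_dvd_not_less prime_imp_coprime)
      then obtain i where "[j * i = 1] (mod ?p)"
        using cong_solve_coprime_nat by auto
      then have "of_nat (j * i) = (1::'a)"
        by (metis of_nat_1 of_nat_eq_iff_cong_CHAR)
      then have "of_nat i * (of_nat j * x) = x"
        by (metis mult.assoc mult.commute mult_1 of_nat_mult)
      with Hmult[OF *, of i] x show False
        by simp
    qed
    define K where "K = (\<lambda>(h, j). h + of_nat j * x) ` (H \<times> {..<?p})"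
    have Huminus: "h - h' \<in> H" if "h \<in> H" "h' \<in> H" for h h'
    proof -
      have "of_nat (?p - 1) * h' = - h'"
        using prime_gt_0_nat[OF p] of_nat_diff[of 1 ?p, where ?'a = 'a] by simp
      then show ?thesis
        using Hadd[OF that(1) Hmult[OF that(2), of "?p - 1"]] by simp
    qed
    have step: "i = j" if "h \<in> H" "h' \<in> H" "i \<le> j" "j < ?p"
      "h + of_nat i * x = h' + of_nat j * x" for h h' i j
    proof (rule ccontr)
      assume "i \<noteq> j"
      with that have "of_nat (j - i) * x = h - h'" "0 < j - i" "j - i < ?p"
        by (auto simp: of_nat_diff algebra_simps)
      then show False
        using not_mult Huminus that by metis
    qed
    have "inj_on (\<lambda>(h, j). h + of_nat j * x) (H \<times> {..<?p})"
    proof (rule inj_onI, clarsimp)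
      fix h h' i j assume *: "h \<in> H" "h' \<in> H" "i < ?p" "j < ?p"
        "h + of_nat i * x = h' + of_nat j * x"
      then have "i = j"
        using step[of h h' i j] step[of h' h j i] by (cases "i \<le> j") auto
      with * show "h = h' \<and> i = j"
        by simp
    qed
    then have card: "card K = ?p ^ Suc k"
      by (simp add: K_def card_image card_cartesian_product k)
    have "subgp K"
      unfolding subgp_def
    proof (intro conjI ballI)
      show "0 \<in> K"
        unfolding K_def using H0 p prime_gt_0_nat by (auto intro!: image_eqI[of _ _ "(0, 0)"])
      fix u v assume "u \<in> K" "v \<in> K"
      then obtain h i h' j where *: "h \<in> H" "h' \<in> H" "u = h + of_nat i * x" "v = h' + of_nat j * x"
        by (auto simp: K_def)
      have "of_nat (i + j) = (of_nat ((i + j) mod ?p) :: 'a)"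
        by (simp only: of_nat_eq_iff_cong_CHAR) (simp add: cong_def)
      then have "u + v = (h + h') + of_nat ((i + j) mod ?p) * x"
        using * by (metis (no_types, lifting) add.assoc add.left_commute distrib_right of_nat_add)
      moreover have "(i + j) mod ?p < ?p"
        using p prime_gt_0_nat by simp
      ultimately show "u + v \<in> K"
        unfolding K_def using Hadd * by (auto intro!: image_eqI[of _ _ "(h + h', (i + j) mod ?p)"])
    qed
    with card have "good K"
      unfolding good_def by blast
    then have "?p ^ Suc k \<le> ?p ^ k"
      using maxH k card by metis
    then show False
      using prime_gt_1_nat[OF p] by auto
  qed
  with k show ?thesis
    by auto
qed

lemma card_eq_CHAR_power_degree: "CARD('a::{finite,field}) = CHAR('a) ^ field_degree TYPE('a)"
proof -
  obtain m where m: "CARD('a) = CHAR('a) ^ m"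
    using card_eq_CHAR_power by blast
  have "(THE m. CARD('a) = CHAR('a) ^ m) = m"
    using m prime_gt_1_nat[OF prime_CHAR[where ?'a = 'a]] by (intro the_equality) auto
  with m show ?thesis
    by (simp add: field_degree_def)
qed

lemma field_degree_pos: "field_degree TYPE('a::{finite,field}) > 0"
proof (rule ccontr)
  assume "\<not> ?thesis"
  then have "CARD('a) = 1"
    using card_eq_CHAR_power_degree[where ?'a = 'a] by simp
  then show False
    by (metis UNIV_I card_1_singletonE singletonD zero_neq_one)
qed

lemma field_trace_add: "field_trace (x + y) = field_trace x + field_trace y"
  unfolding field_trace_def
  by (simp add: freshmans_dream'[OF prime_CHAR refl] sum.distrib)

text \<open>Frobenius shifts the summands cyclically: the last one becomes \<open>x\<close> to the
  power \<open>q\<close>, which is \<open>x\<close>, the first summand.\<close>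

lemma field_trace_power_CHAR:
  fixes x :: "'a::{finite,field}"
  shows "field_trace x ^ CHAR('a) = field_trace x"
proof -
  let ?p = "CHAR('a)" and ?m = "field_degree TYPE('a)"
  have "field_trace x ^ ?p = (\<Sum>j<?m. x ^ (?p ^ Suc j))"
    unfolding field_trace_def
    by (simp add: freshmans_dream_sum[OF prime_CHAR refl] mult.commute flip: power_mult)
  also have "\<dots> + x ^ (?p ^ 0) = (\<Sum>j<Suc ?m. x ^ (?p ^ j))"
    by (simp only: sum.lessThan_Suc_shift add.commute)
  also have "\<dots> = field_trace x + x"
    using card_eq_CHAR_power_degree[where ?'a = 'a] power_card_eq_same[of x]
    by (simp add: field_trace_def)
  finally show ?thesis
    by simp
qed

text \<open>The polynomial \<open>X^p - X\<close> has at most \<open>p\<close> roots, and the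
  \<open>p\<close> elements of the prime field already are roots.\<close>

lemma fixed_by_CHAR_power_imp_of_nat:
  fixes x :: "'a::{finite,field}"
  assumes "x ^ CHAR('a) = x"
  shows "\<exists>k<CHAR('a). of_nat k = x"
proof -
  let ?p = "CHAR('a)"
  define f :: "'a poly" where "f = monom 1 ?p - monom 1 1"
  have p: "?p > 1"
    using prime_gt_1_nat[OF prime_CHAR] .
  have deg: "degree f = ?p"
    unfolding f_def using p by (intro antisym degree_diff_le le_degree) (auto simp: degree_monom_eq)
  then have f0: "f \<noteq> 0"
    using p by auto
  have root: "poly f y = 0 \<longleftrightarrow> y ^ ?p = y" for y
    by (simp add: f_def poly_monom)
  have nat_root: "of_nat k ^ ?p = (of_nat k :: 'a)" for k
    by (induction k) (use p in \<open>auto simp: freshmans_dream[OF prime_CHAR refl]\<close>)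
  have inj: "inj_on (of_nat :: nat \<Rightarrow> 'a) {..<?p}"
    by (auto intro!: inj_onI simp: of_nat_eq_iff_cong_CHAR cong_def)
  have "(of_nat :: nat \<Rightarrow> 'a) ` {..<?p} = {y. poly f y = 0}"
  proof (rule card_subset_eq)
    show "of_nat ` {..<?p} \<subseteq> {y. poly f y = 0}"
      using nat_root root by auto
    have "card {y. poly f y = 0} \<le> ?p"
      using card_poly_roots_bound[OF f0] deg by simp
    moreover have "card ((of_nat :: nat \<Rightarrow> 'a) ` {..<?p}) = ?p"
      using card_image[OF inj] by simp
    moreover have "card ((of_nat :: nat \<Rightarrow> 'a) ` {..<?p}) \<le> card {y. poly f y = 0}"
      using nat_root root by (intro card_mono) auto
    ultimately show "card ((of_nat :: nat \<Rightarrow> 'a) ` {..<?p}) = card {y. poly f y = 0}"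
      by linarith
  qed auto
  then have "x \<in> of_nat ` {..<?p}"
    using assms root by blast
  then show ?thesis
    by auto
qed

text \<open>The exponential has period \<open>p\<close> in \<open>k\<close>, so any natural number
  representing the trace may stand in the exponent. Additivity then follows without reducing a sum
  of representatives.\<close>

lemma add_char_eq:
  fixes x :: "'a::{finite,field}"
  assumes "of_nat k = field_trace x"
  shows "add_char x = exp (2 * of_real pi * \<i> * of_nat k / of_nat CHAR('a))"
proof -
  let ?p = "CHAR('a)"
  have p: "?p > 0"
    using prime_gt_0_nat[OF prime_CHAR] .
  have "(THE k. k < ?p \<and> of_nat k = field_trace x) = k mod ?p"
    using assms p
    by (intro the_equality) (auto simp: of_nat_eq_iff_cong_CHAR cong_def simp flip: assms)
  moreover have "exp (2 * of_real pi * \<i> * of_nat k / of_nat ?p) =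
      exp (2 * of_real pi * \<i> * of_nat (k mod ?p) / of_nat ?p)"
  proof -
    have "of_nat k / of_nat ?p = (of_nat (k div ?p) + of_nat (k mod ?p) / of_nat ?p :: complex)"
      using p by (simp add: field_simps flip: of_nat_mult of_nat_add)
    then have "2 * of_real pi * \<i> * of_nat k / of_nat ?p =
        2 * of_real pi * \<i> * of_nat (k mod ?p) / of_nat ?p
          + of_nat (k div ?p) * (2 * of_real pi * \<i>)"
      by (simp only: times_divide_eq_right[symmetric]) (simp add: algebra_simps)
    then show ?thesis
      by (simp add: exp_add exp_of_nat_mult)
  qed
  ultimately show ?thesis
    by (simp add: add_char_def)
qed

lemma field_trace_of_nat:
  obtains k where "k < CHAR('a)" "of_nat k = field_trace (x::'a::{finite,field})"
  using fixed_by_CHAR_power_imp_of_nat field_trace_power_CHAR by blast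

lemma add_char_add: "add_char (x + y) = add_char x * add_char y"
proof -
  obtain i j where "of_nat i = field_trace x" "of_nat j = field_trace y"
    using field_trace_of_nat by metis
  note ij = this
  then have "of_nat (i + j) = field_trace (x + y)"
    by (simp add: field_trace_add)
  then show ?thesis
    by (simp add: add_char_eq[OF ij(1)] add_char_eq[OF ij(2)] add_char_eq[of "i + j"] exp_add
        add_divide_distrib distrib_left)
qed

lemma add_char_zero [simp]: "add_char 0 = 1"
proof -
  have "of_nat 0 = field_trace (0::'a)"
    using prime_gt_0_nat[OF prime_CHAR[where ?'a = 'a]] by (simp add: field_trace_def)
  then show ?thesis
    using add_char_eq[of 0] by auto
qed

lemma add_char_sum: "add_char (sum f S) = (\<Prod>i\<in>S. add_char (f i))"
  by (induction S rule: infinite_finite_induct) (auto simp: add_char_add)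

text \<open>As a polynomial the trace has linear coefficient 1 and degree below \<open>q\<close>, so
  it cannot vanish at all \<open>q\<close> elements.\<close>

lemma field_trace_nonzero: "\<exists>x::'a::{finite,field}. field_trace x \<noteq> 0"
proof (rule ccontr)
  assume "\<not> ?thesis"
  then have zero: "field_trace (x::'a) = 0" for x
    by simp
  let ?p = "CHAR('a)" and ?m = "field_degree TYPE('a)"
  have p: "?p > 1"
    using prime_gt_1_nat[OF prime_CHAR] .
  define f :: "'a poly" where "f = (\<Sum>j<?m. monom 1 (?p ^ j))"
  have root: "poly f x = 0" for x
    using zero[of x] by (simp add: f_def poly_sum poly_monom field_trace_def)
  have "coeff f 1 = (\<Sum>j<?m. if j = 0 then 1 else 0)"
    unfolding f_def coeff_sum using p by (intro sum.cong) auto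
  then have f0: "f \<noteq> 0"
    using field_degree_pos[where ?'a = 'a] by auto
  have "?p ^ j \<le> ?p ^ (?m - 1)" if "j < ?m" for j
    using that p by (intro power_increasing) auto
  then have "degree f \<le> ?p ^ (?m - 1)"
    unfolding f_def by (intro degree_sum_le) (auto simp: degree_monom_eq)
  also have "\<dots> < ?p ^ ?m"
    using p field_degree_pos[where ?'a = 'a] by (intro power_strict_increasing) auto
  finally show False
    using card_poly_roots_bound[OF f0] root card_eq_CHAR_power_degree[where ?'a = 'a] by simp
qed

text \<open>An element \<open>x\<close> of nonzero trace gives a root of unity with exponent
  \<open>k / p\<close> that is not an integer. The factor \<open>t = x / y\<close> carries
  \<open>y\<close> to \<open>x\<close>.\<close>

lemma add_char_nontrivial:
  assumes "y \<noteq> 0"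
  shows "\<exists>t. add_char (t * y :: 'a::{finite,field}) \<noteq> 1"
proof -
  obtain x :: 'a where x: "field_trace x \<noteq> 0"
    using field_trace_nonzero by blast
  obtain k where k: "k < CHAR('a)" "of_nat k = field_trace x"
    using field_trace_of_nat by blast
  have "add_char x \<noteq> 1"
  proof
    assume "add_char x = 1"
    then have "exp (\<i> * of_real (2 * pi * (real k / real CHAR('a)))) = 1"
      using k add_char_eq[OF k(2)] by (simp add: mult_ac)
    then have "cos (2 * pi * (real k / real CHAR('a))) = 1"
      by (metis cis.sel(1) cis_conv_exp one_complex.sel(1))
    then obtain i :: int where "2 * pi * (real k / real CHAR('a)) = of_int i * 2 * pi"
      by (auto simp: cos_one_2pi_int)
    then have "2 * pi * (real k / real CHAR('a)) = 2 * pi * of_int i"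
      by (simp only: mult_ac)
    then have "real k / real CHAR('a) = of_int i"
      by (subst (asm) mult_cancel_left) simp
    then have "real_of_int (int k) = of_int (i * int CHAR('a))"
      using k by (simp add: field_simps)
    then have "int k = i * int CHAR('a)"
      by (simp only: of_int_eq_iff)
    then have "CHAR('a) dvd k"
      by (metis dvd_triv_right int_dvd_int_iff)
    with k x show False
      by (metis of_nat_eq_0_iff_char_dvd)
  qed
  then have "add_char (x / y * y) \<noteq> 1"
    using assms by simp
  then show ?thesis
    by blast
qed

section \<open>Linear codes over a finite field\<close>

abbreviation subspace_vec :: "nat \<Rightarrow> 'a::field vec set \<Rightarrow> bool" where
  "subspace_vec n C \<equiv> VectorSpace.subspace class_ring C (module_vec TYPE('a) n)"

lemma subspace_vec_iff:
  "subspace_vec n C \<longleftrightarrow> C \<subseteq> carrier_vec n \<and> 0\<^sub>v n \<in> C \<and>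
     (\<forall>x\<in>C. \<forall>y\<in>C. x + y \<in> C) \<and> (\<forall>a. \<forall>x\<in>C. a \<cdot>\<^sub>v x \<in> C)"
  (is "?L \<longleftrightarrow> ?R")
proof
  assume ?L
  then show ?R
    unfolding VectorSpace.subspace_def submodule_def
    by (auto simp: module_vec_simps class_ring_simps)
next
  assume ?R
  then show ?L
    unfolding VectorSpace.subspace_def submodule_def
    using vec_module[where ?'a = 'a] vec_vs[where ?'a = 'a]
    by (auto simp: module_vec_simps class_ring_simps)
qed

lemma
  assumes "subspace_vec n C"
  shows subspace_vec_carrier: "x \<in> C \<Longrightarrow> x \<in> carrier_vec n"
    and subspace_vec_subset: "C \<subseteq> carrier_vec n"
    and subspace_vec_zero: "0\<^sub>v n \<in> C"
    and subspace_vec_add: "x \<in> C \<Longrightarrow> y \<in> C \<Longrightarrow> x + y \<in> C"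
    and subspace_vec_smult: "x \<in> C \<Longrightarrow> a \<cdot>\<^sub>v x \<in> C"
  using assms by (auto simp: subspace_vec_iff)

lemma subspace_vec_diff:
  assumes "subspace_vec n C" "x \<in> C" "y \<in> C"
  shows "x - y \<in> C"
proof -
  have "x - y = x + (- 1) \<cdot>\<^sub>v y"
    using subspace_vec_carrier[OF assms(1)] assms(2,3) by (intro eq_vecI) auto
  then show ?thesis
    using subspace_vec_add[OF assms(1,2)] subspace_vec_smult[OF assms(1,3)] by metis
qed

lemma
  fixes x y :: "'a::ab_group_add vec"
  assumes "x \<in> carrier_vec n" "y \<in> carrier_vec n"
  shows vec_diff_add_cancel: "x - y + y = x" and vec_add_diff_cancel: "x + y - y = x"
  using assms by (auto intro!: eq_vecI)

lemma
  assumes "subspace_vec n C" "x \<in> C" "y \<in> C"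
  shows subspace_vec_diff_add: "x - y + y = x" and subspace_vec_add_diff: "x + y - y = x"
  using assms by (auto simp: subspace_vec_iff intro: vec_diff_add_cancel vec_add_diff_cancel)

lemma subspace_vec_carrier_vec: "subspace_vec n (carrier_vec n)"
  by (simp add: subspace_vec_iff)

lemma subspace_vec_Int:
  "subspace_vec n C \<Longrightarrow> subspace_vec n D \<Longrightarrow> subspace_vec n (C \<inter> D)"
  by (auto simp: subspace_vec_iff)

lemma subspace_vec_dual:
  assumes "C \<subseteq> carrier_vec n"
  shows "subspace_vec n (dual_code n C)"
proof -
  have "(x + y) \<bullet> z = 0" if "x \<in> carrier_vec n" "y \<in> carrier_vec n" "z \<in> C" "x \<bullet> z = 0" "y \<bullet> z = 0"
    for x y z
    using that add_scalar_prod_distrib[of x n y z] assms by auto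
  moreover have "(a \<cdot>\<^sub>v x) \<bullet> z = 0" if "x \<in> carrier_vec n" "z \<in> C" "x \<bullet> z = 0" for a x z
    using that smult_scalar_prod_distrib[of x n z a] assms by auto
  moreover have "0\<^sub>v n \<bullet> z = 0" if "z \<in> C" for z
    using that assms scalar_prod_left_zero[of z n] by auto
  ultimately show ?thesis
    by (simp add: subspace_vec_iff dual_code_def subset_iff)
qed

section \<open>Dimension as the exponent of a cardinality\<close>

lemma bij_betw_vec_lists:
  "bij_betw list_of_vec (carrier_vec n :: 'a vec set) {xs. length xs = n}"
proof (rule bij_betw_byWitness[of _ vec_of_list])
  show "list_of_vec ` (carrier_vec n :: 'a vec set) \<subseteq> {xs. length xs = n}"
  proof (rule image_subsetI)
    fix v :: "'a vec" assume "v \<in> carrier_vec n"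
    then show "list_of_vec v \<in> {xs. length xs = n}"
      by (simp add: carrier_vecD)
  qed
  show "vec_of_list ` {xs. length xs = n} \<subseteq> (carrier_vec n :: 'a vec set)"
    by (rule image_subsetI, rule carrier_vecI) simp
qed (simp_all add: vec_list list_vec)

lemma
  shows finite_carrier_vec [simp]: "finite (carrier_vec n :: 'a::finite vec set)"
    and card_carrier_vec: "card (carrier_vec n :: 'a vec set) = CARD('a) ^ n"
proof -
  have *: "{xs :: 'a list. length xs = n} = {xs. set xs \<subseteq> UNIV \<and> length xs = n}"
    by auto
  have bij: "bij_betw list_of_vec (carrier_vec n :: 'a vec set) {xs. set xs \<subseteq> UNIV \<and> length xs = n}"
    using bij_betw_vec_lists[where ?'a = 'a, of n] unfolding * .
  show "finite (carrier_vec n :: 'a vec set)"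
    using bij_betw_finite[OF bij] finite_lists_length_eq[of "UNIV :: 'a set" n] by simp
  show "card (carrier_vec n :: 'a vec set) = CARD('a) ^ n"
    using bij_betw_same_card[OF bij] card_lists_length_eq[of "UNIV :: 'a set" n] by simp
qed

lemma finite_subspace_vec: "subspace_vec n C \<Longrightarrow> finite (C :: 'a::{finite,field} vec set)"
  by (rule finite_subset[OF subspace_vec_subset finite_carrier_vec])

lemma card_subspace_vec_pos: "subspace_vec n C \<Longrightarrow> card (C :: 'a::{finite,field} vec set) > 0"
  using finite_subspace_vec[of C n] subspace_vec_zero[of C n] by (auto simp: card_gt_0_iff)

text \<open>\<open>G\<close> is a generator matrix in column form. The bijection turns
  \<open>code_dim\<close>, defined through an abstract vector space, into a number of
  codewords.\<close>

lemma basis_matrix_exists: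
  assumes C: "subspace_vec n (C :: 'a::{finite,field} vec set)"
  obtains G where "G \<in> carrier_mat n (code_dim n C)"
    "bij_betw (\<lambda>v. G *\<^sub>v v) (carrier_vec (code_dim n C)) C"
proof -
  interpret V: vec_space "TYPE('a)" n .
  have sub: "submodule class_ring C V.V"
    using C by (simp add: VectorSpace.subspace_def)
  interpret W: vectorspace class_ring "V.vs C"
    by (rule V.subspace_is_vs[OF C])
  \<comment> \<open>Span and dependence inside the subspace agree with those in the ambient space,
    where the matrix lemmas live.\<close>
  have span: "W.span S = V.span S" and li: "W.lin_dep S = V.lin_dep S" if "S \<subseteq> C" for S
    using V.span_li_not_depend[OF that sub] by auto
  have "W.fin_dim"
    unfolding W.fin_dim_def
  proof (intro exI[of _ C] conjI)
    show "W.gen_set C"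
      using W.in_own_span[of C] W.span_is_subset2[of C] by auto
  qed (use finite_subspace_vec[OF C] in auto)
  then obtain \<beta> where \<beta>: "finite \<beta>" "W.basis \<beta>"
    using W.finite_basis_exists by blast
  then have \<beta>C: "\<beta> \<subseteq> C" and gen: "V.span \<beta> = C" and indpt: "V.lin_indpt \<beta>"
    using span li by (auto simp: W.basis_def)
  have dim: "code_dim n C = card \<beta>"
    using W.dim_basis[OF \<beta>] by (simp add: code_dim_def)
  obtain bs where bs: "set bs = \<beta>" "distinct bs"
    using \<beta>(1) finite_distinct_list by blast
  define G where "G = mat_of_cols n bs"
  have bsC: "set bs \<subseteq> carrier_vec n"
    using bs \<beta>C subspace_vec_subset[OF C] by auto
  have len: "length bs = code_dim n C"
    using bs dim distinct_card by metis
  have G: "G \<in> carrier_mat n (code_dim n C)"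
    by (simp add: G_def flip: len)
  have cols: "cols G = bs"
    using bsC by (simp add: G_def cols_mat_of_cols)
  have image: "(\<lambda>v. G *\<^sub>v v) ` carrier_vec (code_dim n C) = C"
  proof -
    have "C = {y \<in> carrier_vec n. \<exists>x\<in>carrier_vec (code_dim n C). G *\<^sub>v x = y}"
      using V.col_space_eq[OF G] gen G by (simp add: V.col_space_def cols bs)
    also have "\<dots> = (\<lambda>v. G *\<^sub>v v) ` carrier_vec (code_dim n C)"
      using mult_mat_vec_carrier[OF G] by auto
    finally show ?thesis ..
  qed
  have inj: "inj_on (\<lambda>v. G *\<^sub>v v) (carrier_vec (code_dim n C))"
  proof (rule inj_onI)
    fix u v assume uv: "u \<in> carrier_vec (code_dim n C)" "v \<in> carrier_vec (code_dim n C)"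
      and eq: "G *\<^sub>v u = G *\<^sub>v v"
    have "G *\<^sub>v (u - v) = G *\<^sub>v u - G *\<^sub>v v"
      using mult_minus_distrib_mat_vec[OF G uv] .
    also have "\<dots> = 0\<^sub>v n"
      using G eq by (intro eq_vecI) auto
    finally have "u - v = 0\<^sub>v (code_dim n C)"
      using V.lin_depI[OF G, of "u - v"] uv indpt bs cols by auto
    then have "(u - v) $ i = 0" if "i < code_dim n C" for i
      using that by simp
    then show "u = v"
      using uv by (intro eq_vecI) auto
  qed
  show thesis
    using that[OF G] image inj by (auto simp: bij_betw_def)
qed

lemma card_subspace_vec:
  assumes "subspace_vec n (C :: 'a::{finite,field} vec set)"
  shows "card C = CARD('a) ^ code_dim n C"
  using basis_matrix_exists[OF assms] bij_betw_same_card card_carrier_vec by metis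

lemma one_less_card_field: "CARD('a::{finite,field}) > 1"
proof -
  have "card {0, 1 :: 'a} \<le> CARD('a)"
    by (rule card_mono) auto
  then show ?thesis
    by simp
qed

lemma code_dim_eqI:
  assumes "subspace_vec n (C :: 'a::{finite,field} vec set)" "card C = CARD('a) ^ k"
  shows "code_dim n C = k"
  using card_subspace_vec[OF assms(1)] assms(2) one_less_card_field[where ?'a = 'a] by simp

text \<open>Every fibre of \<open>f\<close> is a translate of \<open>K\<close>. Asking only for this
  instead of linearity lets one lemma serve matrix products, whose values are vectors, and
  coordinate maps, whose values are scalars.\<close>

lemma card_fibres:
  assumes C: "subspace_vec n (C :: 'a::{finite,field} vec set)"
    and f: "\<And>x y. x \<in> C \<Longrightarrow> y \<in> C \<Longrightarrow> f x = f y \<longleftrightarrow> x - y \<in> K" and K: "K \<subseteq> C"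
  shows "card C = card (f ` C) * card K"
proof -
  have carr: "x \<in> carrier_vec n" if "x \<in> C" for x
    using subspace_vec_carrier[OF C that] .
  have "card {x \<in> C. f x = f y} = card K" if y: "y \<in> C" for y
  proof (rule bij_betw_same_card, rule bij_betw_byWitness[of _ "\<lambda>z. z + y"])
    show "\<forall>x\<in>{x \<in> C. f x = f y}. x - y + y = x"
      using vec_diff_add_cancel[OF carr carr[OF y]] by simp
    show "\<forall>z\<in>K. z + y - y = z"
      using vec_add_diff_cancel[OF carr carr[OF y]] K by blast
    show "(\<lambda>x. x - y) ` {x \<in> C. f x = f y} \<subseteq> K"
    proof clarify
      fix x assume "x \<in> C" "f x = f y"
      then show "x - y \<in> K"
        using f[of x y] y by blast
    qed
    show "(\<lambda>z. z + y) ` K \<subseteq> {x \<in> C. f x = f y}"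
    proof clarify
      fix z assume z: "z \<in> K"
      then have zy: "z + y \<in> C"
        using K y subspace_vec_add[OF C] by blast
      have "z + y - y = z"
        using z K y carr by (intro vec_add_diff_cancel) auto
      then show "z + y \<in> C \<and> f (z + y) = f y"
        using f[OF zy y] z zy by simp
    qed
  qed
  then have "card {x \<in> C. f x = w} = card K" if "w \<in> f ` C" for w
    using that by blast
  then have "(\<Sum>w\<in>f ` C. card {x \<in> C. f x = w}) = (\<Sum>w\<in>f ` C. card K)"
    by (rule sum.cong[OF refl])
  then show ?thesis
    using sum.image_gen[OF finite_subspace_vec[OF C], of "\<lambda>_. 1::nat" f] by simp
qed

section \<open>Duality of codes from character sums\<close>

lemma sum_add_char_subspace:
  assumes C: "subspace_vec n (C :: 'a::{finite,field} vec set)" and y: "y \<in> carrier_vec n"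
  shows "(\<Sum>x\<in>C. add_char (y \<bullet> x)) = (if y \<in> dual_code n C then of_nat (card C) else 0)"
proof (cases "y \<in> dual_code n C")
  case True
  then show ?thesis
    by (auto simp: dual_code_def)
next
  case False
  then obtain z where z: "z \<in> C" "y \<bullet> z \<noteq> 0"
    using y by (auto simp: dual_code_def)
  then obtain t where t: "add_char (t * (y \<bullet> z)) \<noteq> 1"
    using add_char_nontrivial by blast
  \<comment> \<open>Translation by \<open>x0\<close> permutes \<open>C\<close> and multiplies the
    sum by a factor different from 1, so the sum is zero.\<close>
  define x0 where "x0 = t \<cdot>\<^sub>v z"
  have x0: "x0 \<in> C" "add_char (y \<bullet> x0) \<noteq> 1"
    using t subspace_vec_smult[OF C z(1)]
    by (simp_all add: x0_def scalar_prod_smult_distrib[OF y subspace_vec_carrier[OF C z(1)]])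
  have "(\<Sum>x\<in>C. add_char (y \<bullet> x)) = (\<Sum>x\<in>C. add_char (y \<bullet> (x + x0)))"
    by (rule sum.reindex_bij_witness[of _ "\<lambda>x. x + x0" "\<lambda>x. x - x0"])
      (use x0 subspace_vec_add[OF C] subspace_vec_diff[OF C] in
        \<open>simp_all add: subspace_vec_diff_add[OF C] subspace_vec_add_diff[OF C]\<close>)
  also have "\<dots> = (\<Sum>x\<in>C. add_char (y \<bullet> x) * add_char (y \<bullet> x0))"
    by (intro sum.cong refl, subst scalar_prod_add_distrib[OF y subspace_vec_carrier[OF C]
          subspace_vec_carrier[OF C x0(1)]]) (simp_all add: add_char_add)
  also have "\<dots> = (\<Sum>x\<in>C. add_char (y \<bullet> x)) * add_char (y \<bullet> x0)"
    by (simp add: sum_distrib_right)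
  finally show ?thesis
    using x0 False by simp
qed

text \<open>The double character sum over \<open>C\<close> and \<open>D\<close>, evaluated in either
  order, gives the two sides. Taking the whole space for \<open>D\<close> yields the size of the
  dual; in general it is the reason why the two formulas for \<open>c\<close> agree.\<close>

lemma card_dual_Int:
  assumes C: "subspace_vec n (C :: 'a::{finite,field} vec set)" and D: "subspace_vec n D"
  shows "card C * card (dual_code n C \<inter> D) = card D * card (C \<inter> dual_code n D)"
proof -
  have 1: "(\<Sum>y\<in>D. \<Sum>x\<in>C. add_char (y \<bullet> x)) = of_nat (card C * card (dual_code n C \<inter> D))"
    if C: "subspace_vec n C" and D: "subspace_vec n D" for C D :: "'a vec set"
  proof -
    have "(\<Sum>y\<in>D. \<Sum>x\<in>C. add_char (y \<bullet> x)) =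
        (\<Sum>y\<in>D. if y \<in> dual_code n C then of_nat (card C) else 0)"
      by (intro sum.cong refl sum_add_char_subspace[OF C] subspace_vec_carrier[OF D])
    also have "\<dots> = (\<Sum>y\<in>dual_code n C \<inter> D. of_nat (card C))"
      using sum.inter_restrict[OF finite_subspace_vec[OF D], of "\<lambda>_. complex_of_nat (card C)" "dual_code n C"]
      by (simp only: Int_commute)
    finally show ?thesis
      by (simp add: mult.commute)
  qed
  have "(\<Sum>y\<in>D. \<Sum>x\<in>C. add_char (y \<bullet> x)) = (\<Sum>x\<in>C. \<Sum>y\<in>D. add_char (y \<bullet> x))"
    by (rule sum.swap)
  also have "\<dots> = (\<Sum>x\<in>C. \<Sum>y\<in>D. add_char (x \<bullet> y))"
    by (intro sum.cong refl arg_cong[where f = add_char]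
        comm_scalar_prod[OF subspace_vec_carrier[OF D] subspace_vec_carrier[OF C]])
  finally have "complex_of_nat (card C * card (dual_code n C \<inter> D)) =
      of_nat (card D * card (dual_code n D \<inter> C))"
    by (simp only: 1[OF C D] 1[OF D C])
  then show ?thesis
    by (simp only: of_nat_eq_iff Int_commute)
qed

lemma card_dual:
  assumes C: "subspace_vec n (C :: 'a::{finite,field} vec set)"
  shows "card C * card (dual_code n C) = CARD('a) ^ n"
proof -
  have "dual_code n (carrier_vec n) = {0\<^sub>v n :: 'a vec}"
  proof (intro equalityI subsetI)
    fix x :: "'a vec" assume x: "x \<in> dual_code n (carrier_vec n)"
    have "x $ i = 0" if "i < n" for i
    proof -
      have "x \<bullet> unit_vec n i = 0"
        using x by (simp add: dual_code_def)
      then show ?thesis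
        using that x by (simp add: dual_code_def)
    qed
    then show "x \<in> {0\<^sub>v n}"
      using x by (auto simp: dual_code_def)
  qed (auto simp: dual_code_def)
  then have "C \<inter> dual_code n (carrier_vec n) = {0\<^sub>v n}"
    using subspace_vec_zero[OF C] by auto
  moreover have "dual_code n C \<inter> carrier_vec n = dual_code n C"
    by (auto simp: dual_code_def)
  ultimately show ?thesis
    using card_dual_Int[OF C subspace_vec_carrier_vec] by (simp add: card_carrier_vec)
qed

text \<open>One inclusion is symmetry of the scalar product; the size formula, applied twice, makes
  it an equality.\<close>

lemma dual_dual:
  assumes C: "subspace_vec n (C :: 'a::{finite,field} vec set)"
  shows "dual_code n (dual_code n C) = C"
proof -
  have D: "subspace_vec n (dual_code n C)"
    by (rule subspace_vec_dual[OF subspace_vec_subset[OF C]])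
  have DD: "subspace_vec n (dual_code n (dual_code n C))"
    by (rule subspace_vec_dual[OF subspace_vec_subset[OF D]])
  have "C \<subseteq> dual_code n (dual_code n C)"
    using subspace_vec_carrier[OF C] comm_scalar_prod[of _ n] by (fastforce simp: dual_code_def)
  moreover have "card C = card (dual_code n (dual_code n C))"
    using card_dual[OF C] card_dual[OF D] card_subspace_vec_pos[OF D]
    by (metis mult.commute mult_left_cancel less_irrefl)
  ultimately show ?thesis
    using card_subset_eq[OF finite_subspace_vec[OF DD]] by metis
qed

lemma code_dim_dual:
  assumes C: "subspace_vec n (C :: 'a::{finite,field} vec set)"
  shows "code_dim n C + code_dim n (dual_code n C) = n"
proof -
  have "CARD('a) ^ (code_dim n C + code_dim n (dual_code n C)) = CARD('a) ^ n"
    using card_dual[OF C] card_subspace_vec[OF C]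
      card_subspace_vec[OF subspace_vec_dual[OF subspace_vec_subset[OF C]]]
    by (simp add: power_add)
  then show ?thesis
    by (rule power_inject_exp[OF one_less_card_field, THEN iffD1])
qed

lemma code_dim_dual_Int:
  assumes C: "subspace_vec n (C :: 'a::{finite,field} vec set)" and D: "subspace_vec n D"
  shows "code_dim n C + code_dim n (dual_code n C \<inter> D) =
    code_dim n D + code_dim n (C \<inter> dual_code n D)"
proof -
  have CD: "subspace_vec n (dual_code n C \<inter> D)"
    by (rule subspace_vec_Int[OF subspace_vec_dual[OF subspace_vec_subset[OF C]] D])
  have DC: "subspace_vec n (C \<inter> dual_code n D)"
    by (rule subspace_vec_Int[OF C subspace_vec_dual[OF subspace_vec_subset[OF D]]])
  have "CARD('a) ^ (code_dim n C + code_dim n (dual_code n C \<inter> D)) =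
      CARD('a) ^ (code_dim n D + code_dim n (C \<inter> dual_code n D))"
    using card_dual_Int[OF C D]
    unfolding card_subspace_vec[OF C] card_subspace_vec[OF D] card_subspace_vec[OF CD]
      card_subspace_vec[OF DC]
    by (simp add: power_add)
  then show ?thesis
    by (rule power_inject_exp[OF one_less_card_field, THEN iffD1])
qed

section \<open>The EA-CSS construction\<close>

text \<open>The transposed generator matrix of the dual code works: its kernel is the double dual.
  Its rows are independent, which the bijection records.\<close>

lemma parity_check_matrix_exists:
  assumes C: "subspace_vec n (C :: 'a::{finite,field} vec set)"
  obtains H where "parity_check_matrix n C H"
    "bij_betw (\<lambda>u. H\<^sup>T *\<^sub>v u) (carrier_vec (n - code_dim n C)) (dual_code n C)"
proof -
  have D: "subspace_vec n (dual_code n C)"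
    by (rule subspace_vec_dual[OF subspace_vec_subset[OF C]])
  have dim: "code_dim n (dual_code n C) = n - code_dim n C"
    using code_dim_dual[OF C] by simp
  obtain G where G: "G \<in> carrier_mat n (n - code_dim n C)"
    "bij_betw (\<lambda>u. G *\<^sub>v u) (carrier_vec (n - code_dim n C)) (dual_code n C)"
    using basis_matrix_exists[OF D] unfolding dim by blast
  have "x \<in> mat_kernel G\<^sup>T \<longleftrightarrow> x \<in> dual_code n (dual_code n C)" for x
  proof -
    have "G\<^sup>T *\<^sub>v x = 0\<^sub>v (n - code_dim n C) \<longleftrightarrow>
        (\<forall>u\<in>carrier_vec (n - code_dim n C). x \<bullet> (G *\<^sub>v u) = 0)" if x: "x \<in> carrier_vec n"
    proof
      assume *: "G\<^sup>T *\<^sub>v x = 0\<^sub>v (n - code_dim n C)"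
      then show "\<forall>u\<in>carrier_vec (n - code_dim n C). x \<bullet> (G *\<^sub>v u) = 0"
        using transpose_vec_mult_scalar[OF G(1) _ x] by (metis scalar_prod_left_zero)
    next
      assume *: "\<forall>u\<in>carrier_vec (n - code_dim n C). x \<bullet> (G *\<^sub>v u) = 0"
      show "G\<^sup>T *\<^sub>v x = 0\<^sub>v (n - code_dim n C)"
      proof (rule eq_vecI)
        fix i assume "i < dim_vec (0\<^sub>v (n - code_dim n C) :: 'a vec)"
        then have i: "i < n - code_dim n C"
          by simp
        have "(G\<^sup>T *\<^sub>v x) \<bullet> unit_vec (n - code_dim n C) i = 0"
          using transpose_vec_mult_scalar[OF G(1) _ x] * by simp
        then show "(G\<^sup>T *\<^sub>v x) $ i = 0\<^sub>v (n - code_dim n C) $ i"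
          using i G x by simp
      qed (use G in auto)
    qed
    moreover have "mat_kernel G\<^sup>T = {x \<in> carrier_vec n. G\<^sup>T *\<^sub>v x = 0\<^sub>v (n - code_dim n C)}"
      by (rule mat_kernel) (use G in simp)
    moreover have "x \<in> dual_code n (dual_code n C) \<longleftrightarrow>
        x \<in> carrier_vec n \<and> (\<forall>u\<in>carrier_vec (n - code_dim n C). x \<bullet> (G *\<^sub>v u) = 0)"
      unfolding bij_betw_imp_surj_on[OF G(2), symmetric] by (simp add: dual_code_def)
    ultimately show ?thesis
      by blast
  qed
  then have "mat_kernel G\<^sup>T = C"
    using dual_dual[OF C] by blast
  then show thesis
    using that[of "G\<^sup>T"] G by (simp add: parity_check_matrix_def)
qed

lemma subspace_vec_range_mat:
  fixes A :: "'a::field mat"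
  assumes A: "A \<in> carrier_mat nr nc"
  shows "subspace_vec nr ((\<lambda>x. A *\<^sub>v x) ` carrier_vec nc)"
  unfolding subspace_vec_iff
proof (intro conjI ballI allI)
  show "(\<lambda>x. A *\<^sub>v x) ` carrier_vec nc \<subseteq> carrier_vec nr"
    using A by auto
  show "0\<^sub>v nr \<in> (\<lambda>x. A *\<^sub>v x) ` carrier_vec nc"
    by (rule image_eqI[of _ _ "0\<^sub>v nc"]) (use A in auto)
  fix x y assume "x \<in> (\<lambda>x. A *\<^sub>v x) ` carrier_vec nc" "y \<in> (\<lambda>x. A *\<^sub>v x) ` carrier_vec nc"
  then obtain u v where "u \<in> carrier_vec nc" "v \<in> carrier_vec nc" "x = A *\<^sub>v u" "y = A *\<^sub>v v"
    by blast
  then show "x + y \<in> (\<lambda>x. A *\<^sub>v x) ` carrier_vec nc"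
    using mult_add_distrib_mat_vec[OF A] by (intro image_eqI[of _ _ "u + v"]) auto
next
  fix a x assume "x \<in> (\<lambda>x. A *\<^sub>v x) ` carrier_vec nc"
  then obtain u where "u \<in> carrier_vec nc" "x = A *\<^sub>v u"
    by blast
  then show "a \<cdot>\<^sub>v x \<in> (\<lambda>x. A *\<^sub>v x) ` carrier_vec nc"
    using mult_mat_vec[OF A] by (intro image_eqI[of _ _ "a \<cdot>\<^sub>v u"]) auto
qed

text \<open>The dual of the row space is the kernel, so dualizing once more recovers the row space.
  This is needed for an arbitrary parity-check matrix, because a given code \<open>Q\<close> comes
  with matrices that were chosen elsewhere.\<close>

lemma parity_check_row_space:
  assumes C: "subspace_vec n (C :: 'a::{finite,field} vec set)" and H: "parity_check_matrix n C H"
  shows "(\<lambda>u. H\<^sup>T *\<^sub>v u) ` carrier_vec (dim_row H) = dual_code n C"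
proof -
  let ?R = "(\<lambda>u. H\<^sup>T *\<^sub>v u) ` carrier_vec (dim_row H)"
  obtain k where Hk: "H \<in> carrier_mat k n" and ker: "mat_kernel H = C"
    using H by (auto simp: parity_check_matrix_def)
  then have k: "dim_row H = k"
    by simp
  have HT: "H\<^sup>T \<in> carrier_mat n k"
    using Hk by simp
  have R: "subspace_vec n ?R"
    unfolding k by (rule subspace_vec_range_mat[OF HT])
  have "x \<in> C" if x: "x \<in> dual_code n ?R" for x
  proof -
    have xn: "x \<in> carrier_vec n" and *: "\<And>u. u \<in> carrier_vec k \<Longrightarrow> x \<bullet> (H\<^sup>T *\<^sub>v u) = 0"
      using x by (auto simp: dual_code_def k)
    have "H *\<^sub>v x = 0\<^sub>v k"
    proof (rule eq_vecI)
      fix i assume "i < dim_vec (0\<^sub>v k :: 'a vec)"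
      then have i: "i < k"
        by simp
      have "(H\<^sup>T *\<^sub>v unit_vec k i) \<bullet> x = unit_vec k i \<bullet> (H *\<^sub>v x)"
        by (rule transpose_vec_mult_scalar[OF Hk xn]) simp
      moreover have "x \<bullet> (H\<^sup>T *\<^sub>v unit_vec k i) = (H\<^sup>T *\<^sub>v unit_vec k i) \<bullet> x"
        by (rule comm_scalar_prod[of _ n]) (use xn HT in auto)
      moreover have "H *\<^sub>v x \<in> carrier_vec k"
        using Hk xn by simp
      ultimately show "(H *\<^sub>v x) $ i = 0\<^sub>v k $ i"
        using *[of "unit_vec k i"] i by simp
    qed (use Hk in simp)
    then show ?thesis
      using ker mat_kernel[OF Hk] xn by auto
  qed
  moreover have "x \<in> dual_code n ?R" if x: "x \<in> C" for x
  proof -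
    have xn: "x \<in> carrier_vec n" and *: "H *\<^sub>v x = 0\<^sub>v k"
      using x ker mat_kernel[OF Hk] by auto
    have "x \<bullet> (H\<^sup>T *\<^sub>v u) = 0" if u: "u \<in> carrier_vec k" for u
    proof -
      have "x \<bullet> (H\<^sup>T *\<^sub>v u) = (H\<^sup>T *\<^sub>v u) \<bullet> x"
        by (rule comm_scalar_prod[of _ n]) (use xn HT u in auto)
      also have "\<dots> = u \<bullet> (H *\<^sub>v x)"
        by (rule transpose_vec_mult_scalar[OF Hk xn u])
      finally show ?thesis
        using * u by simp
    qed
    then show ?thesis
      using xn by (auto simp: dual_code_def k)
  qed
  ultimately have "dual_code n ?R = C"
    by blast
  then show ?thesis
    using dual_dual[OF R] by simp
qed

lemma rank_eq_code_dim:
  fixes A :: "'a::field mat"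
  assumes A: "A \<in> carrier_mat nr nc"
  shows "vec_space.rank nr A = code_dim nr ((\<lambda>x. A *\<^sub>v x) ` carrier_vec nc)"
proof -
  interpret V: vec_space "TYPE('a)" nr .
  have "V.col_space A = (\<lambda>x. A *\<^sub>v x) ` carrier_vec nc"
    using V.col_space_eq[OF A] A mult_mat_vec_carrier[OF A] by auto
  then show ?thesis
    by (simp add: V.rank_def code_dim_def V.col_space_def)
qed

text \<open>The columns of \<open>F\<close> are a basis of the column space, and row
  \<open>j\<close> of \<open>G\<close> holds the coordinates of column \<open>j\<close> of
  \<open>A\<close> in that basis.\<close>

lemma rank_factorization:
  fixes A :: "'a::{finite,field} mat"
  assumes A: "A \<in> carrier_mat nr nc"
  obtains F G where "F \<in> carrier_mat nr (vec_space.rank nr A)"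
    "G \<in> carrier_mat nc (vec_space.rank nr A)" "A = F * G\<^sup>T"
proof -
  let ?c = "vec_space.rank nr A"
  obtain F where F: "F \<in> carrier_mat nr ?c"
    "bij_betw (\<lambda>v. F *\<^sub>v v) (carrier_vec ?c) ((\<lambda>x. A *\<^sub>v x) ` carrier_vec nc)"
    using basis_matrix_exists[OF subspace_vec_range_mat[OF A]] unfolding rank_eq_code_dim[OF A]
    by blast
  have "\<exists>w\<in>carrier_vec ?c. F *\<^sub>v w = col A j" if "j < nc" for j
  proof -
    have "A *\<^sub>v unit_vec nc j = col A j"
      using A that by (intro eq_vecI) auto
    then have "col A j \<in> (\<lambda>v. F *\<^sub>v v) ` carrier_vec ?c"
      using F(2) unfolding bij_betw_def by (metis image_eqI unit_vec_carrier)
    then show ?thesis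
      by auto
  qed
  then obtain w where w: "\<And>j. j < nc \<Longrightarrow> w j \<in> carrier_vec ?c"
    "\<And>j. j < nc \<Longrightarrow> F *\<^sub>v w j = col A j"
    by metis
  define G where "G = mat nc ?c (\<lambda>(j, l). w j $ l)"
  have "A = F * G\<^sup>T"
  proof (rule eq_matI)
    fix i j assume "i < dim_row (F * G\<^sup>T)" "j < dim_col (F * G\<^sup>T)"
    then have ij: "i < nr" "j < nc"
      using F by (auto simp: G_def)
    have "row G j = w j"
    proof (rule eq_vecI)
      fix l assume "l < dim_vec (w j)"
      with w(1)[OF ij(2)] have "l < ?c"
        by simp
      with ij show "row G j $ l = w j $ l"
        by (simp add: G_def)
    qed (use ij w(1)[OF ij(2)] in \<open>simp add: G_def\<close>)
    then have "(F * G\<^sup>T) $$ (i, j) = (F *\<^sub>v w j) $ i"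
      using ij F(1) by (simp add: G_def)
    then show "A $$ (i, j) = (F * G\<^sup>T) $$ (i, j)"
      using w(2)[OF ij(2)] ij A by simp
  qed (use F(1) A in \<open>simp_all add: G_def\<close>)
  moreover have "G \<in> carrier_mat nc ?c"
    by (simp add: G_def)
  ultimately show thesis
    using that[OF F(1)] by blast
qed

text \<open>A vector \<open>v\<close> is in the kernel of \<open>H_X * H_Z\<^sup>T\<close> iff
  \<open>H_Z\<^sup>T *\<^sub>v v\<close> lies in \<open>C_X\<close>, and these products run exactly
  once through the dual of \<open>C_Z\<close>. So the kernel is as large as
  \<open>C_X \<inter> dual_code n C_Z\<close>, and counting fibres gives the rank, which has to be
  \<open>c\<close>.\<close>

lemma EA_CSS_code_exists:
  assumes X: "subspace_vec n (C_X :: 'a::{finite,field} vec set)" and Z: "subspace_vec n C_Z"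
  obtains Q where "EA_CSS_code n (n - code_dim n C_Z - code_dim n (C_X \<inter> dual_code n C_Z)) C_X C_Z Q"
proof -
  obtain H_X where H_X: "parity_check_matrix n C_X H_X"
    using parity_check_matrix_exists[OF X] by blast
  obtain H_Z where H_Z: "parity_check_matrix n C_Z H_Z"
    and bij: "bij_betw (\<lambda>u. H_Z\<^sup>T *\<^sub>v u) (carrier_vec (n - code_dim n C_Z)) (dual_code n C_Z)"
    using parity_check_matrix_exists[OF Z] by blast
  define kx kz where "kx = n - code_dim n C_X" and "kz = n - code_dim n C_Z"
  have HX: "H_X \<in> carrier_mat kx n" and kerX: "mat_kernel H_X = C_X"
    using H_X by (auto simp: parity_check_matrix_def kx_def)
  have HZ: "H_Z \<in> carrier_mat kz n" and HZT: "H_Z\<^sup>T \<in> carrier_mat n kz"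
    using H_Z by (auto simp: parity_check_matrix_def kz_def)
  have bij: "bij_betw (\<lambda>u. H_Z\<^sup>T *\<^sub>v u) (carrier_vec kz) (dual_code n C_Z)"
    using bij by (simp add: kz_def)
  define M where "M = H_X * H_Z\<^sup>T"
  have M: "M \<in> carrier_mat kx kz"
    using HX HZ by (simp add: M_def)
  have Mv: "M *\<^sub>v v = H_X *\<^sub>v (H_Z\<^sup>T *\<^sub>v v)" if "v \<in> carrier_vec kz" for v
    unfolding M_def by (rule assoc_mult_mat_vec[OF HX HZT that])
  define K where "K = {v \<in> carrier_vec kz. M *\<^sub>v v = 0\<^sub>v kx}"
  let ?I = "C_X \<inter> dual_code n C_Z"
  have I: "subspace_vec n ?I"
    by (rule subspace_vec_Int[OF X subspace_vec_dual[OF subspace_vec_subset[OF Z]]])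
  have "(\<lambda>u. H_Z\<^sup>T *\<^sub>v u) ` K = ?I"
  proof -
    have "v \<in> K \<longleftrightarrow> H_Z\<^sup>T *\<^sub>v v \<in> C_X" if "v \<in> carrier_vec kz" for v
    proof -
      have "H_Z\<^sup>T *\<^sub>v v \<in> carrier_vec n"
        using HZT that by simp
      then show ?thesis
        using that Mv[OF that] kerX mat_kernel[OF HX] by (auto simp: K_def)
    qed
    then have "K = {v \<in> carrier_vec kz. H_Z\<^sup>T *\<^sub>v v \<in> C_X}"
      by (auto simp: K_def)
    then show ?thesis
      unfolding bij_betw_imp_surj_on[OF bij, symmetric] by blast
  qed
  moreover have "inj_on (\<lambda>u. H_Z\<^sup>T *\<^sub>v u) K"
    using bij by (auto simp: bij_betw_def K_def intro: inj_on_subset)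
  ultimately have cardK: "card K = CARD('a) ^ code_dim n ?I"
    using card_image card_subspace_vec[OF I] by metis
  have "card (carrier_vec kz :: 'a vec set) = card ((\<lambda>v. M *\<^sub>v v) ` carrier_vec kz) * card K"
  proof (rule card_fibres[OF subspace_vec_carrier_vec])
    fix u v :: "'a vec" assume uv: "u \<in> carrier_vec kz" "v \<in> carrier_vec kz"
    have *: "M *\<^sub>v u \<in> carrier_vec kx" "M *\<^sub>v v \<in> carrier_vec kx"
      using M uv by auto
    have "M *\<^sub>v u - M *\<^sub>v v = 0\<^sub>v kx \<longleftrightarrow> M *\<^sub>v u = M *\<^sub>v v"
      using * vec_diff_add_cancel[OF *] by (metis left_zero_vec minus_cancel_vec)
    then show "M *\<^sub>v u = M *\<^sub>v v \<longleftrightarrow> u - v \<in> K"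
      using uv mult_minus_distrib_mat_vec[OF M uv] by (auto simp: K_def)
  qed (auto simp: K_def)
  then have "CARD('a) ^ kz = CARD('a) ^ (vec_space.rank kx M + code_dim n ?I)"
    using card_subspace_vec[OF subspace_vec_range_mat[OF M]] rank_eq_code_dim[OF M] cardK
    by (simp add: card_carrier_vec power_add)
  then have "kz = vec_space.rank kx M + code_dim n ?I"
    by (rule power_inject_exp[OF one_less_card_field, THEN iffD1])
  then have rank: "n - code_dim n C_Z - code_dim n ?I = vec_space.rank kx M"
    by (simp add: kz_def)
  obtain F G where FG: "F \<in> carrier_mat kx (vec_space.rank kx M)"
    "G \<in> carrier_mat kz (vec_space.rank kx M)" "M = F * G\<^sup>T"
    using rank_factorization[OF M] by blast
  \<comment> \<open>The sign demanded by the construction is absorbed into the X factor.\<close>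
  have neg: "- M = (- F) * G\<^sup>T"
    using FG by (metis transpose_carrier_mat uminus_mult_left_mat carrier_matD index_transpose_mat(2))
  show thesis
  proof (rule that)
    show "EA_CSS_code n (n - code_dim n C_Z - code_dim n ?I) C_X C_Z
      {\<psi> \<in> state_space n (vec_space.rank kx M).
               \<forall>u\<in>carrier_vec (dim_row H_X). \<forall>v\<in>carrier_vec (dim_row H_Z).
                 X_op n (vec_space.rank kx M) (H_X\<^sup>T *\<^sub>v u) ((- F)\<^sup>T *\<^sub>v u)
                   (Z_op n (vec_space.rank kx M) (H_Z\<^sup>T *\<^sub>v v) (G\<^sup>T *\<^sub>v v) \<psi>) = \<psi>}"
      unfolding EA_CSS_code_def rank
    proof (intro exI conjI)
      show "parity_check_matrix n C_X H_X" "parity_check_matrix n C_Z H_Z"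
        using H_X H_Z .
      show "vec_space.rank kx M = vec_space.rank (dim_row H_X) (H_X * H_Z\<^sup>T)"
        using HX by (simp add: M_def)
      show "- F \<in> carrier_mat (dim_row H_X) (vec_space.rank kx M)"
        "G \<in> carrier_mat (dim_row H_Z) (vec_space.rank kx M)"
        using FG HX HZ by auto
      show "- (H_X * H_Z\<^sup>T) = - F * G\<^sup>T"
        using neg by (simp add: M_def)
    qed (rule refl)
  qed
qed

section \<open>Recovery of an erased qudit\<close>

text \<open>The form pulled back along \<open>f\<close> takes at \<open>v\<close> the value of the
  original form at the push-forward \<open>V\<close>, which sums \<open>v\<close> over the fibres.
  Hence \<open>f\<close> may identify labels.\<close>

lemma positive_op_reindex:
  fixes v :: "'p \<Rightarrow> complex" and f :: "'p \<Rightarrow> 'b"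
  assumes P: "finite P" and B: "finite B" and f: "f ` P \<subseteq> B" and M: "positive_op B M"
  defines "S \<equiv> \<Sum>p\<in>P. \<Sum>p'\<in>P. cnj (v p) * M (f p) (f p') * v p'"
  shows "S \<in> \<real> \<and> 0 \<le> Re S"
proof -
  define V where "V s = (\<Sum>p\<in>{p \<in> P. f p = s}. v p)" for s
  define X where "X s = (\<Sum>s'\<in>B. M s s' * V s')" for s
  have "S = (\<Sum>p\<in>P. cnj (v p) * (\<Sum>p'\<in>P. M (f p) (f p') * v p'))"
    by (simp add: S_def sum_distrib_left mult.assoc)
  also have "\<dots> = (\<Sum>p\<in>P. cnj (v p) * (\<Sum>s'\<in>B. M (f p) s' * V s'))"
  proof (intro sum.cong refl arg_cong[where f = "\<lambda>t. cnj (v _) * t"])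
    fix p assume "p \<in> P"
    have "(\<Sum>p'\<in>P. M (f p) (f p') * v p') = (\<Sum>s'\<in>B. \<Sum>p'\<in>{p' \<in> P. f p' = s'}. M (f p) (f p') * v p')"
      by (rule sum.group[OF P B f, symmetric])
    also have "\<dots> = (\<Sum>s'\<in>B. M (f p) s' * V s')"
      by (rule sum.cong[OF refl]) (auto simp: V_def sum_distrib_left intro!: sum.cong)
    finally show "(\<Sum>p'\<in>P. M (f p) (f p') * v p') = (\<Sum>s'\<in>B. M (f p) s' * V s')" .
  qed
  also have "\<dots> = (\<Sum>p\<in>P. cnj (v p) * X (f p))"
    by (simp only: X_def)
  also have "\<dots> = (\<Sum>s\<in>B. \<Sum>p\<in>{p \<in> P. f p = s}. cnj (v p) * X (f p))"
    by (rule sum.group[OF P B f, symmetric])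
  also have "\<dots> = (\<Sum>s\<in>B. cnj (V s) * X s)"
  proof (rule sum.cong[OF refl])
    fix s
    have "(\<Sum>p\<in>{p \<in> P. f p = s}. cnj (v p) * X (f p)) = (\<Sum>p\<in>{p \<in> P. f p = s}. cnj (v p) * X s)"
      by (rule sum.cong[OF refl]) simp
    then show "(\<Sum>p\<in>{p \<in> P. f p = s}. cnj (v p) * X (f p)) = cnj (V s) * X s"
      by (simp only: V_def cnj_sum sum_distrib_right)
  qed
  also have "\<dots> = (\<Sum>s\<in>B. \<Sum>s'\<in>B. cnj (V s) * M s s' * V s')"
    by (simp add: X_def sum_distrib_left mult.assoc)
  finally have "S = (\<Sum>s\<in>B. \<Sum>s'\<in>B. cnj (V s) * M s s' * V s')" .
  then show ?thesis
    using M[unfolded positive_op_def, THEN spec, of V] by (simp only:)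
qed

text \<open>The Kraus operators are the 0-1 matrices with rows \<open>z\<close> in \<open>G\<close> whose only
  nonzero entry is in column \<open>N j z\<close>, divided by $\sqrt m$.\<close>

lemma quantum_channel_reindex:
  fixes N :: "'j \<Rightarrow> 'z \<Rightarrow> 'z"
  assumes A: "finite A" and J: "finite J" and G: "G \<subseteq> A"
    and N: "\<And>j z. j \<in> J \<Longrightarrow> z \<in> G \<Longrightarrow> N j z \<in> A"
    and m: "m > 0" "\<And>s. s \<in> A \<Longrightarrow> card {p \<in> J \<times> G. N (fst p) (snd p) = s} = m"
  shows "quantum_channel A
    (\<lambda>M z z'. if z \<in> G \<and> z' \<in> G then (\<Sum>j\<in>J. M (N j z) (N j z')) / of_nat m else 0)"
    (is "quantum_channel A ?\<Phi>")
  unfolding quantum_channel_def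
proof (intro conjI ballI allI impI)
  fix M assume M: "M \<in> operators A"
  show "?\<Phi> M \<in> operators A"
    using G by (auto simp: operators_def)
  fix N' a assume "N' \<in> operators A"
  show "?\<Phi> (\<lambda>x y. a * M x y + N' x y) = (\<lambda>x y. a * ?\<Phi> M x y + ?\<Phi> N' x y)"
    by (intro ext) (simp add: sum.distrib sum_distrib_left add_divide_distrib)
next
  have finG: "finite G"
    using A G finite_subset by blast
  fix M assume M: "M \<in> operators A"
  have "(\<Sum>x\<in>A. ?\<Phi> M x x) = (\<Sum>x\<in>A. if x \<in> G then (\<Sum>j\<in>J. M (N j x) (N j x)) / of_nat m else 0)"
    by simp
  also have "\<dots> = (\<Sum>x\<in>G. (\<Sum>j\<in>J. M (N j x) (N j x)) / of_nat m)"
    by (rule sum.mono_neutral_cong_right[OF A G]) auto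
  also have "\<dots> = (\<Sum>j\<in>J. \<Sum>x\<in>G. M (N j x) (N j x)) / of_nat m"
    unfolding sum_divide_distrib[symmetric] by (subst sum.swap) (rule refl)
  also have "(\<Sum>j\<in>J. \<Sum>x\<in>G. M (N j x) (N j x)) =
      (\<Sum>p\<in>J \<times> G. M (N (fst p) (snd p)) (N (fst p) (snd p)))"
    by (simp add: sum.cartesian_product case_prod_unfold)
  also have "\<dots> = (\<Sum>s\<in>A. \<Sum>p\<in>{p \<in> J \<times> G. N (fst p) (snd p) = s}.
      M (N (fst p) (snd p)) (N (fst p) (snd p)))"
    by (rule sum.group[symmetric]) (use A J finG N in auto)
  also have "\<dots> = (\<Sum>s\<in>A. \<Sum>p\<in>{p \<in> J \<times> G. N (fst p) (snd p) = s}. M s s)"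
    by (intro sum.cong refl) auto
  \<comment> \<open>Here the count of preimages acts as the completeness relation of the Kraus
    operators, the factor \<open>m\<close> being cancelled by their normalization.\<close>
  also have "\<dots> = (\<Sum>s\<in>A. of_nat m * M s s)"
    using m(2) by (intro sum.cong refl) simp
  also have "\<dots> / of_nat m = (\<Sum>s\<in>A. M s s)"
    using m(1) by (simp flip: sum_distrib_left)
  finally show "(\<Sum>x\<in>A. ?\<Phi> M x x) = (\<Sum>x\<in>A. M x x)" .
next
  have finG: "finite G"
    using A G finite_subset by blast
  fix k :: nat and M :: "('z \<times> nat) opr" 
  assume pos: "positive_op (A \<times> {..<k}) M"
  \<comment> \<open>\<open>f j\<close> is \<open>N j\<close> extended by the identity on the
    auxiliary system, so complete positivity reduces to positivity of reindexed forms.\<close>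
  define f where "f j p = (N j (fst p), snd p)" for j and p :: "'z \<times> nat"
  let ?K = "{..<k}"
  have T: "tensor_id ?\<Phi> M p p' = (if fst p \<in> G \<and> fst p' \<in> G
      then (\<Sum>j\<in>J. M (f j p) (f j p')) / of_nat m else 0)" for p p'
    by (simp add: tensor_id_def f_def case_prod_unfold)
  show "positive_op (A \<times> ?K) (tensor_id ?\<Phi> M)"
    unfolding positive_op_def
  proof (rule allI)
    fix v :: "'z \<times> nat \<Rightarrow> complex"
    define S where "S j = (\<Sum>p\<in>G \<times> ?K. \<Sum>p'\<in>G \<times> ?K. cnj (v p) * M (f j p) (f j p') * v p')" for j
    have GA: "G \<times> ?K \<subseteq> A \<times> ?K" and fin: "finite (A \<times> ?K)"
      using G A by auto
    have "(\<Sum>p\<in>A \<times> ?K. \<Sum>p'\<in>A \<times> ?K. cnj (v p) * tensor_id ?\<Phi> M p p' * v p') =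
        (\<Sum>p\<in>G \<times> ?K. \<Sum>p'\<in>A \<times> ?K. cnj (v p) * tensor_id ?\<Phi> M p p' * v p')"
      by (rule sum.mono_neutral_right[OF fin GA], rule ballI, rule sum.neutral) (auto simp: T)
    also have "\<dots> = (\<Sum>p\<in>G \<times> ?K. \<Sum>p'\<in>G \<times> ?K. cnj (v p) * tensor_id ?\<Phi> M p p' * v p')"
      by (intro sum.cong refl sum.mono_neutral_right[OF fin GA]) (auto simp: T)
    also have "\<dots> = (\<Sum>p\<in>G \<times> ?K. \<Sum>p'\<in>G \<times> ?K. \<Sum>j\<in>J. cnj (v p) * M (f j p) (f j p') * v p' / of_nat m)"
    proof (intro sum.cong refl)
      fix p p' assume "p \<in> G \<times> ?K" "p' \<in> G \<times> ?K"
      then have "tensor_id ?\<Phi> M p p' = (\<Sum>j\<in>J. M (f j p) (f j p')) / of_nat m"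
        unfolding T by auto
      then show "cnj (v p) * tensor_id ?\<Phi> M p p' * v p' =
          (\<Sum>j\<in>J. cnj (v p) * M (f j p) (f j p') * v p' / of_nat m)"
        by (simp add: sum_distrib_left sum_distrib_right sum_divide_distrib)
    qed
    also have "\<dots> = (\<Sum>p\<in>G \<times> ?K. \<Sum>j\<in>J. \<Sum>p'\<in>G \<times> ?K. cnj (v p) * M (f j p) (f j p') * v p' / of_nat m)"
      by (intro sum.cong refl sum.swap)
    also have "\<dots> = (\<Sum>j\<in>J. S j / of_nat m)"
      unfolding S_def sum_divide_distrib by (rule sum.swap)
    finally have eq: "(\<Sum>p\<in>A \<times> ?K. \<Sum>p'\<in>A \<times> ?K. cnj (v p) * tensor_id ?\<Phi> M p p' * v p') =
        (\<Sum>j\<in>J. S j / of_nat m)" .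
    have S: "S j \<in> \<real> \<and> 0 \<le> Re (S j)" if "j \<in> J" for j
      unfolding S_def
    proof (rule positive_op_reindex[OF _ fin _ pos])
      show "finite (G \<times> ?K)"
        using finG by simp
      show "f j ` (G \<times> ?K) \<subseteq> A \<times> ?K"
        using N that by (auto simp: f_def)
    qed
    have "(\<Sum>j\<in>J. S j / of_nat m) \<in> \<real>"
      using S by (intro sum_in_Reals Reals_divide) auto
    moreover have "0 \<le> Re (\<Sum>j\<in>J. S j / of_nat m)"
      unfolding Re_sum using S by (intro sum_nonneg) simp
    ultimately show "(\<Sum>x\<in>A \<times> ?K. \<Sum>y\<in>A \<times> ?K. cnj (v x) * tensor_id ?\<Phi> M x y * v y) \<in> \<real> \<and>
        0 \<le> Re (\<Sum>x\<in>A \<times> ?K. \<Sum>y\<in>A \<times> ?K. cnj (v x) * tensor_id ?\<Phi> M x y * v y)"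
      unfolding eq by simp
  qed
qed

lemma update_vec_carrier [simp]: "v \<in> carrier_vec n \<Longrightarrow> update_vec v i a \<in> carrier_vec n"
  unfolding carrier_vec_def by simp

lemma index_update_vec [simp]:
  "j < dim_vec v \<Longrightarrow> update_vec v i a $ j = (if j = i then a else v $ j)"
  by (simp add: update_vec_def)

lemma scalar_prod_update_vec:
  fixes v w :: "'a::comm_ring_1 vec"
  assumes "v \<in> carrier_vec n" "w \<in> carrier_vec n" "i < n"
  shows "v \<bullet> (update_vec w i a) = v \<bullet> w + v $ i * (a - w $ i)"
proof -
  have "v \<bullet> (update_vec w i a) = (\<Sum>j = 0..<n. v $ j * (update_vec w i a) $ j)"
    using assms by (simp add: scalar_prod_def)
  also have "\<dots> = (\<Sum>j = 0..<n. v $ j * w $ j + (if j = i then v $ i * (a - w $ i) else 0))"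
    using assms by (intro sum.cong refl) (auto simp: algebra_simps)
  also have "\<dots> = v \<bullet> w + v $ i * (a - w $ i)"
    using assms by (simp add: sum.distrib scalar_prod_def)
  finally show ?thesis .
qed

text \<open>The stabilizers $X(t h_X) \otimes X_B(t f_X)$ and $Z(t h_Z) \otimes Z_B(t f_Z)$ force a
  code state \<open>\<psi>\<close> to be invariant under translation by \<open>(h_X, f_X)\<close> and to be supported on
  the labels orthogonal to \<open>(h_Z, f_Z)\<close>. For such a label \<open>(x, y)\<close> the channel below moves
  along \<open>(h_X, f_X)\<close> until coordinate \<open>i\<close> has the value \<open>a\<close> and then overwrites it by \<open>b\<close>.
  Applied to the erased state, this reads off \<open>\<psi>\<close> at a translate of \<open>(x, y)\<close> with \<open>i\<close>-th
  coordinate replaced, which is zero unless the replacement is the true value \<open>a\<close>.\<close>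

lemma recovery_channel:
  fixes h_X h_Z f_X f_Z :: "'a::{finite,field} vec"
  assumes hX: "h_X \<in> carrier_vec n" and hZ: "h_Z \<in> carrier_vec n"
    and fX: "f_X \<in> carrier_vec c" and fZ: "f_Z \<in> carrier_vec c"
    and orth: "h_Z \<bullet> h_X + f_Z \<bullet> f_X = 0"
    and i: "i < n" "i \<in> S" "h_X $ i \<noteq> 0" "h_Z $ i \<noteq> 0"
    and S: "vec_supp h_X \<subseteq> S" "vec_supp h_Z \<subseteq> S"
  obtains \<Phi> where "quantum_channel (local_labels n c S) \<Phi>"
    "\<And>\<psi> z z'. (\<And>x y. (x, y) \<in> labels n c \<Longrightarrow> h_Z \<bullet> x + f_Z \<bullet> y \<noteq> 0 \<Longrightarrow> \<psi> (x, y) = 0) \<Longrightarrow>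
       (\<And>x y t. (x, y) \<in> labels n c \<Longrightarrow> \<psi> (x - t \<cdot>\<^sub>v h_X, y - t \<cdot>\<^sub>v f_X) = \<psi> (x, y)) \<Longrightarrow>
       z \<in> labels n c \<Longrightarrow> z' \<in> labels n c \<Longrightarrow>
       apply_locally n c S \<Phi> (erase_qudit i (ket_bra \<psi>)) z z' = ket_bra \<psi> z z'"
proof -
  let ?q = "CARD('a)"
  define A :: "'a label set" where "A = local_labels n c S"
  define synd where "synd z = h_Z \<bullet> fst z + f_Z \<bullet> snd z" for z :: "'a label"
  define G where "G = {z \<in> A. synd z = 0}"
  define tr where "tr z a = (fst z $ i - a) / h_X $ i" for z :: "'a label" and a
  define N where "N j z = (update_vec (fst z - tr z (fst j) \<cdot>\<^sub>v h_X) i (snd j),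
      snd z - tr z (fst j) \<cdot>\<^sub>v f_X)"
    for j :: "'a \<times> 'a" and z
  define \<Phi> where "\<Phi> M z z' = (if z \<in> G \<and> z' \<in> G
      then (\<Sum>j\<in>UNIV. M (N j z) (N j z')) / of_nat ?q else 0)" for M :: "'a label opr" and z z'
  have AD: "z \<in> A \<longleftrightarrow> fst z \<in> carrier_vec n \<and> snd z \<in> carrier_vec c \<and>
      (\<forall>j<n. j \<notin> S \<longrightarrow> fst z $ j = 0)" for z
    by (auto simp: A_def local_labels_def labels_def mask_def vec_eq_iff case_prod_unfold)
  have hX0: "h_X $ j = 0" and hZ0: "h_Z $ j = 0" if "j < n" "j \<notin> S" for j
    using S that hX hZ by (auto simp: vec_supp_def)
  \<comment> \<open>\<open>orth\<close> expresses that the X and Z stabilizers commute; therefore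
    the translation keeps the syndrome.\<close>
  have synd_move: "synd (x - t \<cdot>\<^sub>v h_X, y - t \<cdot>\<^sub>v f_X) = synd (x, y)"
    if "x \<in> carrier_vec n" "y \<in> carrier_vec c" for x y t
  proof -
    have "synd (x - t \<cdot>\<^sub>v h_X, y - t \<cdot>\<^sub>v f_X) = synd (x, y) - t * (h_Z \<bullet> h_X + f_Z \<bullet> f_X)"
      using that hX hZ fX fZ
      by (simp add: synd_def scalar_prod_minus_distrib[of _ n] scalar_prod_minus_distrib[of _ c]
          algebra_simps)
    then show ?thesis
      using orth by simp
  qed
  have synd_update: "synd (update_vec x i a, y) = synd (x, y) + h_Z $ i * (a - x $ i)"
    if "x \<in> carrier_vec n" for x y a
    using scalar_prod_update_vec[OF hZ that i(1)] by (simp add: synd_def)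
  have channel: "quantum_channel A \<Phi>"
    unfolding \<Phi>_def
  proof (rule quantum_channel_reindex)
    have "A \<subseteq> carrier_vec n \<times> carrier_vec c"
      using AD by (auto simp: mem_Times_iff)
    then show "finite A"
      using finite_subset by fastforce
    show "N j z \<in> A" if "z \<in> G" for j z
      using that hX fX hX0 i by (auto simp: G_def AD N_def)
    show "card {p \<in> UNIV \<times> G. N (fst p) (snd p) = s} = ?q" if s: "s \<in> A" for s
    proof -
      obtain u w :: "'a vec" where uw: "s = (u, w)" "u \<in> carrier_vec n" "w \<in> carrier_vec c"
        "\<And>j. j < n \<Longrightarrow> j \<notin> S \<Longrightarrow> u $ j = 0"
        using s AD by (metis prod.collapse)
      \<comment> \<open>\<open>a0\<close> is the only value of coordinate \<open>i\<close> for which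
        \<open>s\<close> would have syndrome zero. A preimage \<open>((a, b), z)\<close> of
        \<open>s\<close> must have \<open>a = a0\<close> and \<open>b = u $ i\<close>, while the
        distance \<open>t\<close> moved along \<open>(h_X, f_X)\<close> stays free: this gives
        exactly \<open>q\<close> preimages.\<close>
      define a0 where "a0 = u $ i - synd s / h_Z $ i"
      define g where "g t = ((a0, u $ i), (update_vec u i a0 + t \<cdot>\<^sub>v h_X, w + t \<cdot>\<^sub>v f_X))" for t
      have "bij_betw g UNIV {p \<in> UNIV \<times> G. N (fst p) (snd p) = s}"
      proof (rule bij_betw_byWitness[of _ "\<lambda>p. tr (snd p) (fst (fst p))"])
        show "\<forall>t\<in>UNIV. tr (snd (g t)) (fst (fst (g t))) = t"
          using uw i hX by (simp add: g_def tr_def)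
        show "g ` UNIV \<subseteq> {p \<in> UNIV \<times> G. N (fst p) (snd p) = s}"
        proof (rule image_subsetI)
          fix t
          have "synd (update_vec u i a0, w) = 0"
            using i by (simp add: synd_update[OF uw(2)] a0_def uw(1))
          moreover have "(update_vec u i a0 + t \<cdot>\<^sub>v h_X) - t \<cdot>\<^sub>v h_X = update_vec u i a0"
            "(w + t \<cdot>\<^sub>v f_X) - t \<cdot>\<^sub>v f_X = w"
            using uw hX fX by (auto intro!: eq_vecI)
          moreover have "update_vec u i a0 + t \<cdot>\<^sub>v h_X \<in> carrier_vec n" "w + t \<cdot>\<^sub>v f_X \<in> carrier_vec c"
            using uw hX fX by auto
          ultimately have "synd (update_vec u i a0 + t \<cdot>\<^sub>v h_X, w + t \<cdot>\<^sub>v f_X) = 0"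
            using synd_move by metis
          then have "snd (g t) \<in> G"
            using uw hX fX hX0 i by (auto simp: g_def G_def AD)
          moreover have "N (fst (g t)) (snd (g t)) = s"
          proof -
            have "tr (snd (g t)) (fst (fst (g t))) = t"
              using uw i hX by (simp add: g_def tr_def)
            then show ?thesis
              using uw hX fX i by (auto simp: N_def g_def intro!: eq_vecI)
          qed
          ultimately show "g t \<in> {p \<in> UNIV \<times> G. N (fst p) (snd p) = s}"
            by (simp add: mem_Times_iff)
        qed
        show "\<forall>p\<in>{p \<in> UNIV \<times> G. N (fst p) (snd p) = s}. g (tr (snd p) (fst (fst p))) = p"
        proof (rule ballI)
          fix p assume p: "p \<in> {p \<in> UNIV \<times> G. N (fst p) (snd p) = s}"
          obtain a b x y where pe: "p = ((a, b), (x, y))"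
            by (metis prod.collapse)
          with p have xyG: "(x, y) \<in> G" and Ns: "N (a, b) (x, y) = s"
            by auto
          define t where "t = tr (x, y) a"
          have xy: "x \<in> carrier_vec n" "y \<in> carrier_vec c" "synd (x, y) = 0"
            using xyG by (auto simp: G_def AD)
          have u: "u = update_vec (x - t \<cdot>\<^sub>v h_X) i b" and w: "w = y - t \<cdot>\<^sub>v f_X"
            using Ns by (simp_all add: N_def t_def uw(1))
          have xta: "(x - t \<cdot>\<^sub>v h_X) $ i = a"
            using xy i hX by (simp add: t_def tr_def)
          have ub: "u $ i = b"
            using xy i hX by (simp add: u)
          have "synd s = h_Z $ i * (b - a)"
            using synd_update[of "x - t \<cdot>\<^sub>v h_X" b w] synd_move[OF xy(1,2), of t] xy xta hX
            by (simp add: uw(1) u w)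
          then have a0: "a0 = a"
            using i by (simp add: a0_def ub)
          have "update_vec u i a + t \<cdot>\<^sub>v h_X = x"
          proof (rule eq_vecI)
            fix j assume "j < dim_vec x"
            then show "(update_vec u i a + t \<cdot>\<^sub>v h_X) $ j = x $ j"
              using xta xy hX i by (cases "j = i") (auto simp: u)
          qed (use hX xy in \<open>simp add: u\<close>)
          moreover have "w + t \<cdot>\<^sub>v f_X = y"
            using xy fX by (auto simp: w intro!: eq_vecI)
          ultimately show "g (tr (snd p) (fst (fst p))) = p"
            by (simp add: pe g_def ub a0 flip: t_def)
        qed
      qed auto
      then show ?thesis
        using bij_betw_same_card by fastforce
    qed
  qed (auto simp: G_def)
  moreover have "apply_locally n c S \<Phi> (erase_qudit i (ket_bra \<psi>)) z z' = ket_bra \<psi> z z'"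
    if supp: "\<And>x y. (x, y) \<in> labels n c \<Longrightarrow> h_Z \<bullet> x + f_Z \<bullet> y \<noteq> 0 \<Longrightarrow> \<psi> (x, y) = 0"
      and inv: "\<And>x y t. (x, y) \<in> labels n c \<Longrightarrow> \<psi> (x - t \<cdot>\<^sub>v h_X, y - t \<cdot>\<^sub>v f_X) = \<psi> (x, y)"
      and z: "z \<in> labels n c" "z' \<in> labels n c" for \<psi> z z'
  proof -
    define loc where "loc z = (mask S (fst z), snd z)" for z :: "'a label"
    define mv where "mv z a e = (update_vec (fst z - tr z a \<cdot>\<^sub>v h_X) i e, snd z - tr z a \<cdot>\<^sub>v f_X)"
      for z a e
    have lab: "z \<in> labels n c \<longleftrightarrow> fst z \<in> carrier_vec n \<and> snd z \<in> carrier_vec c" for z :: "'a label"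
      by (simp add: labels_def mem_Times_iff)
    have locA: "loc z \<in> A" if "z \<in> labels n c" for z
      using that unfolding lab AD loc_def by (auto simp: mask_def)
    have synd_loc: "synd (loc z) = synd z" if "z \<in> labels n c" for z
    proof -
      have "h_Z \<bullet> mask S (fst z) = h_Z \<bullet> fst z"
        using that hZ hZ0 by (auto simp: lab mask_def scalar_prod_def intro!: sum.cong)
      then show ?thesis
        by (simp add: synd_def loc_def)
    qed
    have G_iff: "loc z \<in> G \<longleftrightarrow> synd z = 0" if "z \<in> labels n c" for z
      using locA[OF that] synd_loc[OF that] by (simp add: G_def)
    have tr_loc: "tr (loc z) a = tr z a" if "z \<in> labels n c" for z a
      using that i by (auto simp: tr_def loc_def mask_def lab)
    have N_loc: "fst (N j (loc z)) + mask (- S) (fst z) = fst (mv z (fst j) (snd j))"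
      "snd (N j (loc z)) = snd (mv z (fst j) (snd j))" if "z \<in> labels n c" for z j
    proof -
      have "N j (loc z) = (update_vec (fst (loc z) - tr z (fst j) \<cdot>\<^sub>v h_X) i (snd j),
          snd (loc z) - tr z (fst j) \<cdot>\<^sub>v f_X)"
        by (simp add: N_def tr_loc[OF that])
      then have N_eq: "N j (loc z) = (update_vec (mask S (fst z) - tr z (fst j) \<cdot>\<^sub>v h_X) i (snd j),
          snd z - tr z (fst j) \<cdot>\<^sub>v f_X)"
        by (simp add: loc_def)
      have "(fst (N j (loc z)) + mask (- S) (fst z)) $ l = fst (mv z (fst j) (snd j)) $ l" if l: "l < n" for l
        using \<open>z \<in> labels n c\<close> l hX i hX0[OF l]
        by (cases "l = i"; cases "l \<in> S") (auto simp: N_eq mv_def lab mask_def)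
      then show "fst (N j (loc z)) + mask (- S) (fst z) = fst (mv z (fst j) (snd j))"
        using \<open>z \<in> labels n c\<close> hX by (intro eq_vecI) (auto simp: mv_def N_eq lab mask_def)
      show "snd (N j (loc z)) = snd (mv z (fst j) (snd j))"
        by (simp add: N_eq mv_def)
    qed
    have psi_mv: "\<psi> (mv z a e) = (if e = a then \<psi> z else 0)"
      if zl: "z \<in> labels n c" and good: "synd z = 0" for z a e
    proof -
      obtain x y where xy: "z = (x, y)" "x \<in> carrier_vec n" "y \<in> carrier_vec c"
        using zl lab by (metis prod.collapse)
      have xia: "(x - tr z a \<cdot>\<^sub>v h_X) $ i = a"
        using xy hX i by (simp add: tr_def)
      have carr: "x - tr z a \<cdot>\<^sub>v h_X \<in> carrier_vec n"
        using xy hX by simp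
      show ?thesis
      proof (cases "e = a")
        case True
        have "update_vec (x - tr z a \<cdot>\<^sub>v h_X) i e = x - tr z a \<cdot>\<^sub>v h_X"
          using xia True by (intro eq_vecI) (auto simp: update_vec_def)
        then have "mv z a e = (x - tr z a \<cdot>\<^sub>v h_X, y - tr z a \<cdot>\<^sub>v f_X)"
          by (simp add: mv_def xy(1))
        then show ?thesis
          using inv[of x y "tr z a"] zl True xy(1) by simp
      next
        case False
        have "synd (mv z a e) = h_Z $ i * (e - a)"
          using synd_update[OF carr, of e "y - tr z a \<cdot>\<^sub>v f_X"] synd_move[OF xy(2,3), of "tr z a"] good xia
          by (simp add: mv_def xy(1))
        then have "synd (mv z a e) \<noteq> 0"
          using False i by simp
        moreover have "mv z a e \<in> labels n c"
          using xy hX fX by (simp add: mv_def lab)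
        ultimately show ?thesis
          using supp[of "fst (mv z a e)" "snd (mv z a e)"] False by (simp add: synd_def)
      qed
    qed
    have psi_bad: "\<psi> z = 0" if "z \<in> labels n c" "synd z \<noteq> 0" for z
      using supp[of "fst z" "snd z"] that by (simp add: synd_def)
    \<comment> \<open>The block of the erased state that \<open>apply_locally\<close> hands to the
      channel, for fixed parts of \<open>z\<close> and \<open>z'\<close> outside
      \<open>S\<close>.\<close>
    define B where "B = (\<lambda>p p'. if p \<in> A \<and> p' \<in> A then erase_qudit i (ket_bra \<psi>)
        (fst p + mask (- S) (fst z), snd p) (fst p' + mask (- S) (fst z'), snd p') else 0)"
    have "apply_locally n c S \<Phi> (erase_qudit i (ket_bra \<psi>)) z z' = \<Phi> B (loc z) (loc z')"
      by (simp add: apply_locally_def B_def A_def loc_def case_prod_unfold)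
    also have "\<dots> = ket_bra \<psi> z z'"
    proof (cases "synd z = 0 \<and> synd z' = 0")
      case True
      have "B (N j (loc z)) (N j (loc z')) = \<psi> z * cnj (\<psi> z') / of_nat ?q" for j
      proof -
        let ?m = "\<lambda>z. mv z (fst j) (snd j)"
        have NA: "N j (loc z) \<in> A" "N j (loc z') \<in> A"
          using locA z hX fX hX0 i by (auto simp: AD N_def)
        have mvi: "fst (?m z) $ i = snd j" "fst (?m z') $ i = snd j"
          using z i hX by (auto simp: mv_def lab)
        have upd: "update_vec (fst (mv z a b)) i e = fst (mv z a e)"
          if "z \<in> labels n c" for z a b e
          using that i hX by (intro eq_vecI) (auto simp: mv_def update_vec_def)
        have "B (N j (loc z)) (N j (loc z')) =
            erase_qudit i (ket_bra \<psi>) (?m z) (?m z')"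
          using NA by (simp add: B_def N_loc[OF z(1)] N_loc[OF z(2)])
        also have "\<dots> = (\<Sum>e\<in>UNIV. \<psi> (update_vec (fst (?m z)) i e, snd (?m z)) *
            cnj (\<psi> (update_vec (fst (?m z')) i e, snd (?m z')))) / of_nat ?q"
          using mvi by (simp add: erase_qudit_def ket_bra_def case_prod_unfold)
        also have "(\<lambda>e. \<psi> (update_vec (fst (?m z)) i e, snd (?m z)) *
            cnj (\<psi> (update_vec (fst (?m z')) i e, snd (?m z')))) =
            (\<lambda>e. \<psi> (mv z (fst j) e) * cnj (\<psi> (mv z' (fst j) e)))"
          using upd[OF z(1)] upd[OF z(2)] by (simp add: mv_def)
        also have "\<dots> = (\<lambda>e. if e = fst j then \<psi> z * cnj (\<psi> z') else 0)"
          using True by (auto simp: psi_mv[OF z(1)] psi_mv[OF z(2)])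
        finally show ?thesis
          by simp
      qed
      \<comment> \<open>All \<open>q^2\<close> pairs \<open>j\<close> contribute equally. One factor
        \<open>1 / q\<close> stems from the maximally mixed qudit, the other from the normalization
        of the channel.\<close>
      then have "\<Phi> B (loc z) (loc z') =
          (\<Sum>j\<in>(UNIV :: ('a \<times> 'a) set). \<psi> z * cnj (\<psi> z') / of_nat ?q) / of_nat ?q"
        using True by (simp add: \<Phi>_def G_iff[OF z(1)] G_iff[OF z(2)])
      also have "\<dots> = \<psi> z * cnj (\<psi> z')"
        by (simp add: card_cartesian_product flip: UNIV_Times_UNIV)
      finally show ?thesis
        by (simp add: ket_bra_def)
    next
      case False
      then have "\<Phi> B (loc z) (loc z') = 0"
        by (auto simp: \<Phi>_def G_iff[OF z(1)] G_iff[OF z(2)])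
      moreover have "ket_bra \<psi> z z' = 0"
        using False psi_bad[OF z(1)] psi_bad[OF z(2)] by (auto simp: ket_bra_def)
      ultimately show ?thesis
        by simp
    qed
    finally show ?thesis .
  qed
  ultimately show thesis
    using that[of \<Phi>] unfolding A_def by blast
qed


section \<open>From local stabilizers of the code to recovery\<close>

lemma Z_op_eq:
  assumes "x \<in> carrier_vec n" "y \<in> carrier_vec c" "b \<in> carrier_vec n" "b' \<in> carrier_vec c"
  shows "Z_op n c b b' \<psi> (x, y) = add_char (b \<bullet> x + b' \<bullet> y) * \<psi> (x, y)"
  using assms by (simp add: Z_op_def add_char_add scalar_prod_def add_char_sum atLeast0LessThan)

text \<open>The local words of the dual codes are row combinations of the given parity-check
  matrices. The same coefficient vectors applied to \<open>F_X\<close> and \<open>F_Z\<close> tell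
  how the corresponding stabilizers act on the receiver.\<close>

lemma EA_CSS_code_locally_recoverable:
  assumes X: "subspace_vec n (C_X :: 'a::{finite,field} vec set)" and Z: "subspace_vec n C_Z"
    and Q: "EA_CSS_code n c C_X C_Z Q" and loc: "support_locality n r C_X C_Z"
  shows "locally_recoverable n c r Q"
  unfolding locally_recoverable_def
proof (intro allI impI)
  fix i assume i: "i < n"
  obtain h_X h_Z where h: "h_X \<in> dual_code n C_X" "h_Z \<in> dual_code n C_Z"
    "i \<in> vec_supp h_X \<inter> vec_supp h_Z" "card (vec_supp h_X \<union> vec_supp h_Z) \<le> r + 1"
    using loc i unfolding support_locality_def by blast
  obtain H_X H_Z F_X F_Z where HX: "parity_check_matrix n C_X H_X" and HZ: "parity_check_matrix n C_Z H_Z"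
    and F: "F_X \<in> carrier_mat (dim_row H_X) c" "F_Z \<in> carrier_mat (dim_row H_Z) c"
    and neg: "- (H_X * H_Z\<^sup>T) = F_X * F_Z\<^sup>T"
    and Qeq: "Q = {\<psi> \<in> state_space n c.
               \<forall>u\<in>carrier_vec (dim_row H_X). \<forall>v\<in>carrier_vec (dim_row H_Z).
                 X_op n c (H_X\<^sup>T *\<^sub>v u) (F_X\<^sup>T *\<^sub>v u)
                   (Z_op n c (H_Z\<^sup>T *\<^sub>v v) (F_Z\<^sup>T *\<^sub>v v) \<psi>) = \<psi>}"
    using Q unfolding EA_CSS_code_def by blast
  define kx kz where "kx = dim_row H_X" and "kz = dim_row H_Z"
  have HXc: "H_X \<in> carrier_mat kx n" "H_X\<^sup>T \<in> carrier_mat n kx"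
    and HZc: "H_Z \<in> carrier_mat kz n" "H_Z\<^sup>T \<in> carrier_mat n kz"
    using HX HZ by (auto simp: parity_check_matrix_def kx_def kz_def)
  have FXc: "F_X \<in> carrier_mat kx c" "F_X\<^sup>T \<in> carrier_mat c kx"
    and FZc: "F_Z \<in> carrier_mat kz c" "F_Z\<^sup>T \<in> carrier_mat c kz"
    using F by (auto simp: kx_def kz_def)
  obtain u where u: "u \<in> carrier_vec kx" "h_X = H_X\<^sup>T *\<^sub>v u"
    using h(1) parity_check_row_space[OF X HX] by (auto simp: kx_def)
  obtain v where v: "v \<in> carrier_vec kz" "h_Z = H_Z\<^sup>T *\<^sub>v v"
    using h(2) parity_check_row_space[OF Z HZ] by (auto simp: kz_def)
  define f_X f_Z where "f_X = F_X\<^sup>T *\<^sub>v u" and "f_Z = F_Z\<^sup>T *\<^sub>v v"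
  have hXc: "h_X \<in> carrier_vec n" and hZc: "h_Z \<in> carrier_vec n"
    and fXc: "f_X \<in> carrier_vec c" and fZc: "f_Z \<in> carrier_vec c"
    using u v HXc HZc FXc FZc by (auto simp: f_X_def f_Z_def)
  have pairing: "(B\<^sup>T *\<^sub>v v) \<bullet> (A\<^sup>T *\<^sub>v u) = u \<bullet> ((A * B\<^sup>T) *\<^sub>v v)"
    if A: "A \<in> carrier_mat kx m" and B: "B \<in> carrier_mat kz m" for A B m
  proof -
    have BT: "B\<^sup>T \<in> carrier_mat m kz"
      using B by simp
    have Bv: "B\<^sup>T *\<^sub>v v \<in> carrier_vec m" and Au: "A\<^sup>T *\<^sub>v u \<in> carrier_vec m"
      using A BT u v by auto
    have "(B\<^sup>T *\<^sub>v v) \<bullet> (A\<^sup>T *\<^sub>v u) = (A\<^sup>T *\<^sub>v u) \<bullet> (B\<^sup>T *\<^sub>v v)"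
      by (rule comm_scalar_prod[OF Bv Au])
    also have "\<dots> = u \<bullet> (A *\<^sub>v (B\<^sup>T *\<^sub>v v))"
      by (rule transpose_vec_mult_scalar[OF A Bv u(1)])
    also have "A *\<^sub>v (B\<^sup>T *\<^sub>v v) = (A * B\<^sup>T) *\<^sub>v v"
      by (rule assoc_mult_mat_vec[OF A BT v(1), symmetric])
    finally show ?thesis .
  qed
  \<comment> \<open>Both products are values of one bilinear form at \<open>u\<close> and
    \<open>v\<close>. The minus sign in the factorization makes the receiver part cancel the failure
    of \<open>h_X\<close> and \<open>h_Z\<close> to be orthogonal.\<close>
  have orth: "h_Z \<bullet> h_X + f_Z \<bullet> f_X = 0"
  proof -
    let ?M = "H_X * H_Z\<^sup>T"
    have M: "?M \<in> carrier_mat kx kz"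
      using HXc HZc by simp
    have "f_Z \<bullet> f_X = u \<bullet> ((- ?M) *\<^sub>v v)"
      unfolding f_X_def f_Z_def neg by (rule pairing[OF FXc(1) FZc(1)])
    also have "(- ?M) *\<^sub>v v = - (?M *\<^sub>v v)"
      using M v by (intro eq_vecI) auto
    also have "u \<bullet> (- (?M *\<^sub>v v)) = - (u \<bullet> (?M *\<^sub>v v))"
      using carrier_vecD[OF u(1)] by (intro scalar_prod_uminus_right) (simp add: kx_def)
    also have "u \<bullet> (?M *\<^sub>v v) = h_Z \<bullet> h_X"
      unfolding u(2) v(2) by (rule pairing[OF HXc(1) HZc(1), symmetric])
    finally show ?thesis
      by simp
  qed
  define S where "S = vec_supp h_X \<union> vec_supp h_Z"
  have finS: "finite S"
    by (simp add: S_def vec_supp_def)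
  have iS: "i \<in> S" "h_X $ i \<noteq> 0" "h_Z $ i \<noteq> 0"
    using h(3) by (auto simp: S_def vec_supp_def)
  obtain \<Phi> where ch: "quantum_channel (local_labels n c S) \<Phi>"
    and rec: "\<And>\<psi> z z'. (\<And>x y. (x, y) \<in> labels n c \<Longrightarrow> h_Z \<bullet> x + f_Z \<bullet> y \<noteq> 0 \<Longrightarrow> \<psi> (x, y) = 0) \<Longrightarrow>
       (\<And>x y t. (x, y) \<in> labels n c \<Longrightarrow> \<psi> (x - t \<cdot>\<^sub>v h_X, y - t \<cdot>\<^sub>v f_X) = \<psi> (x, y)) \<Longrightarrow>
       z \<in> labels n c \<Longrightarrow> z' \<in> labels n c \<Longrightarrow>
       apply_locally n c S \<Phi> (erase_qudit i (ket_bra \<psi>)) z z' = ket_bra \<psi> z z'"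
    using recovery_channel[OF hXc hZc fXc fZc orth i iS] unfolding S_def by (metis Un_upper1 Un_upper2)
  have stab: "X_op n c (s \<cdot>\<^sub>v h_X) (s \<cdot>\<^sub>v f_X) (Z_op n c (t \<cdot>\<^sub>v h_Z) (t \<cdot>\<^sub>v f_Z) \<psi>) = \<psi>"
    if "\<psi> \<in> Q" for \<psi> s t
  proof -
    have all: "\<forall>u\<in>carrier_vec kx. \<forall>v\<in>carrier_vec kz.
        X_op n c (H_X\<^sup>T *\<^sub>v u) (F_X\<^sup>T *\<^sub>v u)
          (Z_op n c (H_Z\<^sup>T *\<^sub>v v) (F_Z\<^sup>T *\<^sub>v v) \<psi>) = \<psi>"
      using that unfolding Qeq kx_def kz_def by blast
    have 1: "H_X\<^sup>T *\<^sub>v (s \<cdot>\<^sub>v u) = s \<cdot>\<^sub>v h_X" "F_X\<^sup>T *\<^sub>v (s \<cdot>\<^sub>v u) = s \<cdot>\<^sub>v f_X"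
      unfolding u(2) f_X_def using mult_mat_vec[OF HXc(2) u(1)] mult_mat_vec[OF FXc(2) u(1)] by auto
    have 2: "H_Z\<^sup>T *\<^sub>v (t \<cdot>\<^sub>v v) = t \<cdot>\<^sub>v h_Z" "F_Z\<^sup>T *\<^sub>v (t \<cdot>\<^sub>v v) = t \<cdot>\<^sub>v f_Z"
      unfolding v(2) f_Z_def using mult_mat_vec[OF HZc(2) v(1)] mult_mat_vec[OF FZc(2) v(1)] by auto
    have "s \<cdot>\<^sub>v u \<in> carrier_vec kx" "t \<cdot>\<^sub>v v \<in> carrier_vec kz"
      using u v by auto
    from bspec[OF bspec[OF all this(1)] this(2)] show ?thesis
      unfolding 1 2 .
  qed
  have stab_xy: "add_char (t * (h_Z \<bullet> (x - s \<cdot>\<^sub>v h_X) + f_Z \<bullet> (y - s \<cdot>\<^sub>v f_X))) *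
      \<psi> (x - s \<cdot>\<^sub>v h_X, y - s \<cdot>\<^sub>v f_X) = \<psi> (x, y)"
    if "\<psi> \<in> Q" and xy: "(x, y) \<in> labels n c" for \<psi> s t x y
  proof -
    have carr: "x - s \<cdot>\<^sub>v h_X \<in> carrier_vec n" "y - s \<cdot>\<^sub>v f_X \<in> carrier_vec c"
      "t \<cdot>\<^sub>v h_Z \<in> carrier_vec n" "t \<cdot>\<^sub>v f_Z \<in> carrier_vec c"
      using xy hXc fXc hZc fZc by (auto simp: labels_def)
    have "\<psi> (x, y) = Z_op n c (t \<cdot>\<^sub>v h_Z) (t \<cdot>\<^sub>v f_Z) \<psi> (x - s \<cdot>\<^sub>v h_X, y - s \<cdot>\<^sub>v f_X)"
      using fun_cong[OF stab[OF that(1), of s t], of "(x, y)"] xy by (simp add: X_op_def)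
    also have "\<dots> = add_char ((t \<cdot>\<^sub>v h_Z) \<bullet> (x - s \<cdot>\<^sub>v h_X) + (t \<cdot>\<^sub>v f_Z) \<bullet> (y - s \<cdot>\<^sub>v f_X)) *
        \<psi> (x - s \<cdot>\<^sub>v h_X, y - s \<cdot>\<^sub>v f_X)"
      by (rule Z_op_eq[OF carr])
    finally show ?thesis
      using smult_scalar_prod_distrib[OF hZc carr(1), of t]
        smult_scalar_prod_distrib[OF fZc carr(2), of t]
      by (simp add: distrib_left)
  qed
  \<comment> \<open>With \<open>s = 0\<close> only the Z stabilizer acts, and a label with nonzero
    syndrome picks up a phase other than 1 for some \<open>t\<close>. The invariance below is the
    opposite case \<open>t = 0\<close>.\<close>
  have zero_psi: "\<psi> (x, y) = 0"
    if "\<psi> \<in> Q" and xy: "(x, y) \<in> labels n c" and nz: "h_Z \<bullet> x + f_Z \<bullet> y \<noteq> 0" for \<psi> x y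
  proof -
    obtain t where t: "add_char (t * (h_Z \<bullet> x + f_Z \<bullet> y)) \<noteq> 1"
      using add_char_nontrivial[OF nz] by blast
    have "x - 0 \<cdot>\<^sub>v h_X = x" "y - 0 \<cdot>\<^sub>v f_X = y"
      using xy hXc fXc by (auto simp: labels_def intro!: eq_vecI)
    then have "add_char (t * (h_Z \<bullet> x + f_Z \<bullet> y)) * \<psi> (x, y) = \<psi> (x, y)"
      using stab_xy[OF that(1) xy, of t 0] by simp
    with t show ?thesis
      by simp
  qed
  have inv_psi: "\<psi> (x - s \<cdot>\<^sub>v h_X, y - s \<cdot>\<^sub>v f_X) = \<psi> (x, y)"
    if "\<psi> \<in> Q" and xy: "(x, y) \<in> labels n c" for \<psi> x y s
    using stab_xy[OF that, of 0 s] by simp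
  have ins: "insert i (S - {i}) = S"
    using iS by auto
  show "\<exists>R\<subseteq>{..<n} - {i}. card R \<le> r \<and> (\<exists>\<Phi>. quantum_channel (local_labels n c (insert i R)) \<Phi> \<and>
      (\<forall>\<psi>\<in>Q. unit_vector n c \<psi> \<longrightarrow> (\<forall>z\<in>labels n c. \<forall>z'\<in>labels n c.
        apply_locally n c (insert i R) \<Phi> (erase_qudit i (ket_bra \<psi>)) z z' = ket_bra \<psi> z z')))"
  proof (intro exI[of _ "S - {i}"] conjI exI[of _ \<Phi>] ballI impI; (unfold ins)?)
    show "S - {i} \<subseteq> {..<n} - {i}"
      using hXc hZc by (auto simp: S_def vec_supp_def)
    show "card (S - {i}) \<le> r"
      using h(4) iS finS by (simp add: S_def)
    show "quantum_channel (local_labels n c S) \<Phi>"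
      by (rule ch)
    fix \<psi> :: "'a label \<Rightarrow> complex" and z z' :: "'a label"
    assume "\<psi> \<in> Q" "z \<in> labels n c" "z' \<in> labels n c"
    then show "apply_locally n c S \<Phi> (erase_qudit i (ket_bra \<psi>)) z z' = ket_bra \<psi> z z'"
      by (intro rec zero_psi inv_psi)
  qed
qed

section \<open>MDS codes\<close>

text \<open>Equality in the Singleton bound, encoded as: any \<open>k\<close> coordinates determine
  a word. This form includes \<open>k = 0\<close>, where \<open>min_dist\<close> has its default
  value 0.\<close>

definition mds_code :: "nat \<Rightarrow> nat \<Rightarrow> 'a::{finite,field} vec set \<Rightarrow> bool" where
  "mds_code n k C \<longleftrightarrow> subspace_vec n C \<and> card C = CARD('a) ^ k \<and> k \<le> n \<and>
     (\<forall>x\<in>C. \<forall>S\<subseteq>{..<n}. card S = k \<longrightarrow> (\<forall>i\<in>S. x $ i = 0) \<longrightarrow> x = 0\<^sub>v n)"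

lemma
  fixes C :: "'a::{finite,field} vec set"
  assumes "mds_code n k C"
  shows mds_code_subspace: "subspace_vec n C"
    and mds_code_card: "card C = CARD('a) ^ k"
    and mds_code_le: "k \<le> n"
    and mds_code_zero: "x \<in> C \<Longrightarrow> S \<subseteq> {..<n} \<Longrightarrow> card S = k \<Longrightarrow>
      (\<And>i. i \<in> S \<Longrightarrow> x $ i = 0) \<Longrightarrow> x = 0\<^sub>v n"
  using assms unfolding mds_code_def by simp_all

text \<open>Restriction to \<open>S\<close> is injective, and code and target both have
  \<open>q^k\<close> elements.\<close>

lemma mds_code_interpolate:
  fixes f :: "nat \<Rightarrow> 'a::{finite,field}"
  assumes C: "mds_code n k C" and S: "S \<subseteq> {..<n}" "card S = k"
  shows "\<exists>x\<in>C. \<forall>i\<in>S. x $ i = f i"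
proof -
  define \<rho> where "\<rho> x = restrict (\<lambda>i. x $ i) S" for x :: "'a vec"
  have carr: "x \<in> carrier_vec n" if "x \<in> C" for x
    using subspace_vec_carrier[OF mds_code_subspace[OF C] that] .
  have finS: "finite S"
    using S finite_subset by blast
  have "inj_on \<rho> C"
  proof (rule inj_onI)
    fix x y assume xy: "x \<in> C" "y \<in> C" and eq: "\<rho> x = \<rho> y"
    have "(x - y) $ i = 0" if "i \<in> S" for i
    proof -
      have "x $ i = y $ i"
        using fun_cong[OF eq, of i] that by (simp add: \<rho>_def)
      moreover have "i < dim_vec y"
        using carr[OF xy(2)] that S by auto
      ultimately show ?thesis
        by simp
    qed
    then have *: "x - y = 0\<^sub>v n"
      using mds_code_zero[OF C subspace_vec_diff[OF mds_code_subspace[OF C] xy] S] by blast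
    show "x = y"
    proof (rule eq_vecI)
      fix i assume i: "i < dim_vec y"
      with * carr[OF xy(2)] have "(x - y) $ i = 0"
        by auto
      with i show "x $ i = y $ i"
        by simp
    qed (use carr[OF xy(1)] carr[OF xy(2)] in auto)
  qed
  then have "card (\<rho> ` C) = CARD('a) ^ k"
    using card_image mds_code_card[OF C] by metis
  moreover have "card (S \<rightarrow>\<^sub>E (UNIV :: 'a set)) = CARD('a) ^ k"
    using finS S by (simp add: card_PiE)
  moreover have "\<rho> ` C \<subseteq> S \<rightarrow>\<^sub>E UNIV"
    by (auto simp: \<rho>_def)
  moreover have "finite (S \<rightarrow>\<^sub>E (UNIV :: 'a set))"
    using finS by (simp add: finite_PiE)
  ultimately have "\<rho> ` C = S \<rightarrow>\<^sub>E UNIV"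
    by (intro card_subset_eq) auto
  moreover have "restrict f S \<in> S \<rightarrow>\<^sub>E UNIV"
    by auto
  ultimately obtain x where x: "x \<in> C" "\<rho> x = restrict f S"
    by (metis imageE)
  have "x $ i = f i" if "i \<in> S" for i
    using fun_cong[OF x(2), of i] that by (simp add: \<rho>_def)
  with x(1) show ?thesis
    by blast
qed

text \<open>If \<open>x\<close> in the dual vanishes on \<open>T\<close>, pair it with a word of
  \<open>C\<close> that is a unit vector on the \<open>k\<close> remaining coordinates: the scalar
  product is a single entry of \<open>x\<close>.\<close>

lemma mds_code_dual:
  assumes C: "mds_code n k (C :: 'a::{finite,field} vec set)"
  shows "mds_code n (n - k) (dual_code n C)"
  unfolding mds_code_def
proof (intro conjI ballI allI impI)
  note sub = mds_code_subspace[OF C]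
  show "subspace_vec n (dual_code n C)"
    by (rule subspace_vec_dual[OF subspace_vec_subset[OF sub]])
  have "CARD('a) ^ k * card (dual_code n C) = CARD('a) ^ k * CARD('a) ^ (n - k)"
    using card_dual[OF sub] mds_code_card[OF C] mds_code_le[OF C] by (simp flip: power_add)
  then show "card (dual_code n C) = CARD('a) ^ (n - k)"
    by simp
  fix x T assume x: "x \<in> dual_code n C" and T: "T \<subseteq> {..<n}" "card T = n - k" "\<forall>i\<in>T. x $ i = 0"
  define S where "S = {..<n} - T"
  have S: "S \<subseteq> {..<n}" "card S = k"
    using T mds_code_le[OF C] by (auto simp: S_def card_Diff_subset finite_subset)
  have xn: "x \<in> carrier_vec n"
    using x by (simp add: dual_code_def)
  have "x $ i = 0" if i: "i < n" for i
  proof (cases "i \<in> T")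
    case False
    with i have iS: "i \<in> S"
      by (simp add: S_def)
    obtain y where y: "y \<in> C" "\<And>j. j \<in> S \<Longrightarrow> y $ j = (if j = i then 1 else 0)"
      using mds_code_interpolate[OF C S, of "\<lambda>j. if j = i then 1 else 0"] by blast
    have yn: "y \<in> carrier_vec n"
      using subspace_vec_carrier[OF sub y(1)] .
    have "x \<bullet> y = (\<Sum>j = 0..<n. x $ j * y $ j)"
      using yn by (simp add: scalar_prod_def)
    also have "\<dots> = (\<Sum>j = 0..<n. if j = i then x $ i else 0)"
    proof (rule sum.cong[OF refl])
      fix j assume "j \<in> {0..<n}"
      then have "j \<in> T \<or> j \<in> S"
        by (auto simp: S_def)
      then show "x $ j * y $ j = (if j = i then x $ i else 0)"
        using T(3) y(2)[of j] False by auto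
    qed
    also have "\<dots> = x $ i"
      using i by simp
    finally show ?thesis
      using x y(1) by (simp add: dual_code_def)
  qed (use T in simp)
  then show "x = 0\<^sub>v n"
    using xn by (intro eq_vecI) auto
qed simp

text \<open>The complement of \<open>T\<close> has \<open>k - 1\<close> elements, so one point of
  \<open>T\<close> completes it to a set on which values can be prescribed: 0 outside
  \<open>T\<close>, 1 at \<open>i\<close>. A further zero at \<open>j\<close> in \<open>T\<close>
  would again leave \<open>k\<close> zeros and kill the word.\<close>

lemma mds_code_support_exists:
  assumes C: "mds_code n k (C :: 'a::{finite,field} vec set)" and T: "T \<subseteq> {..<n}" "card T = n - k + 1"
    and k: "k > 0"
  shows "\<exists>x\<in>C. vec_supp x = T"
proof -
  have finT: "finite T"
    using T finite_subset by blast
  obtain i where i: "i \<in> T"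
    using T by fastforce
  have cardS: "card ({..<n} - T \<union> {j}) = k" if "j \<in> T" for j
  proof -
    have "card ({..<n} - T) = n - card T"
      using T finT by (simp add: card_Diff_subset)
    then have "card ({..<n} - T) = k - 1"
      using T k mds_code_le[OF C] by simp
    then show ?thesis
      using that k by simp
  qed
  have sub: "{..<n} - T \<union> {j} \<subseteq> {..<n}" if "j \<in> T" for j
    using T that by auto
  obtain x where x: "x \<in> C" "\<And>j. j \<in> {..<n} - T \<union> {i} \<Longrightarrow> x $ j = (if j = i then 1 else 0)"
    using mds_code_interpolate[OF C sub[OF i] cardS[OF i], of "\<lambda>j. if j = i then 1 else 0"] by blast
  have xn: "dim_vec x = n"
    using subspace_vec_carrier[OF mds_code_subspace[OF C] x(1)] by auto
  have out: "x $ j = 0" if "j < n" "j \<notin> T" for j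
    using x(2)[of j] that i by auto
  have "x $ j \<noteq> 0" if j: "j \<in> T" for j
  proof
    assume "x $ j = 0"
    then have "x = 0\<^sub>v n"
      using mds_code_zero[OF C x(1) sub[OF j] cardS[OF j]] out by auto
    moreover have "x $ i = 1"
      using x(2)[of i] by simp
    moreover have "i < n"
      using i T by auto
    ultimately show False
      by simp
  qed
  then have "vec_supp x = T"
    using out T xn by (auto simp: vec_supp_def)
  with x(1) show ?thesis
    by blast
qed

lemma mds_code_weight:
  assumes C: "mds_code n k (C :: 'a::{finite,field} vec set)" and x: "x \<in> C" "x \<noteq> 0\<^sub>v n"
  shows "n - k + 1 \<le> hamming_weight x"
proof (rule ccontr)
  assume *: "\<not> ?thesis"
  have xn: "dim_vec x = n"
    using subspace_vec_carrier[OF mds_code_subspace[OF C] x(1)] by auto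
  have "vec_supp x \<subseteq> {..<n}"
    using xn by (auto simp: vec_supp_def)
  then have "card ({..<n} - vec_supp x) = n - hamming_weight x"
    by (simp add: hamming_weight_def card_Diff_subset finite_subset)
  then have "k \<le> card ({..<n} - vec_supp x)"
    using * mds_code_le[OF C] by simp
  then obtain S where S: "S \<subseteq> {..<n} - vec_supp x" "card S = k"
    using obtain_subset_with_card_n by metis
  have "x $ i = 0" if "i \<in> S" for i
    using S that xn by (auto simp: vec_supp_def)
  moreover have "S \<subseteq> {..<n}"
    using S by blast
  ultimately show False
    using mds_code_zero[OF C x(1) _ S(2)] x(2) by blast
qed

lemma mds_code_min_dist:
  assumes C: "mds_code n k (C :: 'a::{finite,field} vec set)" and k: "k > 0"
  shows "min_dist C = n - k + 1"
  unfolding min_dist_def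
proof (rule cInf_eq_minimum)
  note sub = mds_code_subspace[OF C]
  have "\<exists>T\<subseteq>{..<n}. card T = n - k + 1"
    using k mds_code_le[OF C] by (intro exI[of _ "{..<n - k + 1}"]) auto
  then obtain T x where T: "T \<subseteq> {..<n}" "card T = n - k + 1" and x: "x \<in> C" "vec_supp x = T"
    using mds_code_support_exists[OF C _ _ k] by metis
  have xn: "x \<in> carrier_vec n"
    using subspace_vec_carrier[OF sub x(1)] .
  have "{i. i < dim_vec x \<and> x $ i \<noteq> 0\<^sub>v n $ i} = T"
    using x(2) xn by (auto simp: vec_supp_def)
  then have "hamming_dist x (0\<^sub>v n) = n - k + 1"
    using T by (simp add: hamming_dist_def)
  moreover have "x \<noteq> 0\<^sub>v n"
  proof
    assume "x = 0\<^sub>v n"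
    then have "vec_supp x = {}"
      by (auto simp: vec_supp_def)
    with x(2) T(2) show False
      by simp
  qed
  ultimately show "n - k + 1 \<in> {hamming_dist v w | v w. v \<in> C \<and> w \<in> C \<and> v \<noteq> w}"
    using x(1) subspace_vec_zero[OF sub] by fastforce
  fix m assume "m \<in> {hamming_dist v w | v w. v \<in> C \<and> w \<in> C \<and> v \<noteq> w}"
  then obtain v w where vw: "m = hamming_dist v w" "v \<in> C" "w \<in> C" "v \<noteq> w"
    by blast
  have dims: "dim_vec v = n" "dim_vec w = n"
    using subspace_vec_carrier[OF sub] vw by auto
  have "v - w \<noteq> 0\<^sub>v n"
  proof
    assume eq: "v - w = 0\<^sub>v n"
    have "v = w"
    proof (rule eq_vecI)
      fix i assume "i < dim_vec w"
      then show "v $ i = w $ i"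
        using arg_cong[OF eq, of "\<lambda>u. u $ i"] dims by simp
    qed (simp add: dims)
    then show False
      using vw(4) by simp
  qed
  moreover have "hamming_weight (v - w) = m"
    using dims by (auto simp: vw(1) hamming_weight_def hamming_dist_def vec_supp_def intro!: arg_cong[where f = card])
  ultimately show "n - k + 1 \<le> m"
    using mds_code_weight[OF C subspace_vec_diff[OF sub vw(2,3)]] by simp
qed

lemma mds_code_linear_code:
  assumes C: "mds_code n k C" and k: "k > 0"
  shows "linear_code n k (n - k + 1) C"
  unfolding linear_code_def
  using mds_code_subspace[OF C] mds_code_min_dist[OF C k]
    code_dim_eqI[OF mds_code_subspace[OF C] mds_code_card[OF C]]
  by blast

text \<open>Otherwise a word of least weight outside \<open>D\<close> could be shortened by subtracting a
  multiple of a word in \<open>D\<close> of weight $n - k + 1$ whose support lies inside its own.\<close>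

lemma mds_code_wt_Diff:
  assumes C: "mds_code n k (C :: 'a::{finite,field} vec set)" and k: "k > 0"
    and D: "subspace_vec n D" and nsub: "\<not> C \<subseteq> D"
  shows "wt (C - D) = n - k + 1"
proof -
  note sub = mds_code_subspace[OF C]
  define x where "x = arg_min hamming_weight (\<lambda>x. x \<in> C - D)"
  have "\<exists>x. x \<in> C - D"
    using nsub by blast
  then have x: "x \<in> C - D" and xmin: "\<And>y. y \<in> C - D \<Longrightarrow> hamming_weight x \<le> hamming_weight y"
    using arg_min_nat_lemma[of "\<lambda>x. x \<in> C - D" _ hamming_weight] unfolding x_def by auto
  have xC: "x \<in> C" and x0: "x \<noteq> 0\<^sub>v n"
    using x subspace_vec_zero[OF D] by auto
  have xn: "dim_vec x = n"
    using subspace_vec_carrier[OF sub xC] by auto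
  have weight: "n - k + 1 \<le> hamming_weight y" if "y \<in> C - D" for y
    using that subspace_vec_zero[OF D] by (intro mds_code_weight[OF C]) auto
  have "hamming_weight x = n - k + 1"
  proof (rule ccontr)
    assume "hamming_weight x \<noteq> n - k + 1"
    then have less: "n - k + 1 < hamming_weight x"
      using weight[OF x] by simp
    then obtain T where T: "T \<subseteq> vec_supp x" "card T = n - k + 1"
      using obtain_subset_with_card_n[of "n - k + 1" "vec_supp x"] by (auto simp: hamming_weight_def)
    have Tn: "T \<subseteq> {..<n}"
      using T xn by (auto simp: vec_supp_def)
    obtain y where y: "y \<in> C" "vec_supp y = T"
      using mds_code_support_exists[OF C Tn T(2) k] by blast
    have yn: "dim_vec y = n"
      using subspace_vec_carrier[OF sub y(1)] by auto
    have yD: "y \<in> D"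
      using xmin[of y] y T less by (force simp: hamming_weight_def)
    obtain j where j: "j \<in> T"
      using T by fastforce
    define t where "t = x $ j / y $ j"
    define z where "z = x - t \<cdot>\<^sub>v y"
    have zC: "z \<in> C"
      unfolding z_def by (intro subspace_vec_diff[OF sub] subspace_vec_smult[OF sub] xC y(1))
    have "z \<notin> D"
    proof
      assume "z \<in> D"
      then have "z + t \<cdot>\<^sub>v y \<in> D"
        using subspace_vec_add[OF D] subspace_vec_smult[OF D yD] by blast
      moreover have "z + t \<cdot>\<^sub>v y = x"
        using xn yn by (intro eq_vecI) (auto simp: z_def)
      ultimately show False
        using x by simp
    qed
    have "vec_supp z \<subset> vec_supp x"
    proof
      have "z $ i = 0" if "i < n" "x $ i = 0" for i
        using that T y(2) xn yn by (auto simp: z_def vec_supp_def)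
      then show "vec_supp z \<subseteq> vec_supp x"
        using xn yn by (auto simp: vec_supp_def z_def)
      have "y $ j \<noteq> 0" "j < n" "j \<in> vec_supp x"
        using j T y(2) yn by (auto simp: vec_supp_def)
      moreover from this have "z $ j = 0"
        using yn xn by (simp add: z_def t_def)
      ultimately show "vec_supp z \<noteq> vec_supp x"
        by (auto simp: vec_supp_def)
    qed
    then have "hamming_weight z < hamming_weight x"
      unfolding hamming_weight_def by (intro psubset_card_mono) (auto simp: vec_supp_def)
    then show False
      using xmin[of z] zC \<open>z \<notin> D\<close> by auto
  qed
  then show ?thesis
    unfolding wt_def
  proof (intro cInf_eq_minimum)
    assume *: "hamming_weight x = n - k + 1"
    show "n - k + 1 \<in> {hamming_weight v | v. v \<in> C - D \<and> v \<noteq> 0\<^sub>v (dim_vec v)}"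
      using x x0 xn * by (intro CollectI exI[of _ x]) simp
  qed (use weight in auto)
qed

text \<open>Both branches of the definition return the MDS distance; this is where purity comes
  from.\<close>

lemma mds_code_EA_CSS_distance:
  assumes X: "mds_code n k (C_X :: 'a::{finite,field} vec set)" and Z: "mds_code n k C_Z"
    and k: "k > 0"
  shows "EA_CSS_distance n C_X C_Z = n - k + 1"
proof (cases "C_X \<subseteq> dual_code n C_Z")
  case True
  then show ?thesis
    by (simp add: EA_CSS_distance_def mds_code_min_dist[OF X k] mds_code_min_dist[OF Z k])
next
  case False
  note subX = mds_code_subspace[OF X] and subZ = mds_code_subspace[OF Z]
  \<comment> \<open>The definition tests only one inclusion. The other one must fail too, for
    otherwise the second difference would be empty and its \<open>wt\<close> would take the default
    value 0.\<close>
  have "\<not> C_Z \<subseteq> dual_code n C_X"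
  proof
    assume *: "C_Z \<subseteq> dual_code n C_X"
    have "C_X \<subseteq> dual_code n C_Z"
    proof
      fix x assume x: "x \<in> C_X"
      have "x \<bullet> z = 0" if z: "z \<in> C_Z" for z
      proof -
        have "x \<bullet> z = z \<bullet> x"
          by (rule comm_scalar_prod[OF subspace_vec_carrier[OF subX x] subspace_vec_carrier[OF subZ z]])
        then show ?thesis
          using * x z by (auto simp: dual_code_def)
      qed
      then show "x \<in> dual_code n C_Z"
        using subspace_vec_carrier[OF subX x] by (simp add: dual_code_def)
    qed
    with False show False ..
  qed
  then have "wt (C_Z - dual_code n C_X) = n - k + 1"
    by (rule mds_code_wt_Diff[OF Z k subspace_vec_dual[OF subspace_vec_subset[OF subX]]])
  moreover have "wt (C_X - dual_code n C_Z) = n - k + 1"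
    by (rule mds_code_wt_Diff[OF X k subspace_vec_dual[OF subspace_vec_subset[OF subZ]] False])
  moreover have "C_X - C_X \<inter> dual_code n C_Z = C_X - dual_code n C_Z"
    "C_Z - dual_code n C_X \<inter> C_Z = C_Z - dual_code n C_X"
    by auto
  ultimately show ?thesis
    using False by (simp add: EA_CSS_distance_def)
qed

lemma mds_code_support_locality:
  assumes X: "mds_code n k (C_X :: 'a::{finite,field} vec set)" and Z: "mds_code n k C_Z"
    and k: "k < n"
  shows "support_locality n k C_X C_Z"
  unfolding support_locality_def
proof (intro allI impI)
  fix i assume i: "i < n"
  have "k \<le> card ({..<n} - {i})"
    using i k by simp
  then obtain T' where T': "T' \<subseteq> {..<n} - {i}" "card T' = k"
    using obtain_subset_with_card_n by metis
  \<comment> \<open>One set \<open>T\<close> of \<open>k + 1\<close> coordinates serves both dual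
    codes, so the union of the two supports is no larger than each of them.\<close>
  define T where "T = insert i T'"
  have fin: "finite T'"
    using T' finite_subset by blast
  have T: "T \<subseteq> {..<n}" "card T = n - (n - k) + 1" "i \<in> T"
    using T' fin i k by (auto simp: T_def card_insert_if)
  have nk: "0 < n - k"
    using k by simp
  obtain h_X where "h_X \<in> dual_code n C_X" "vec_supp h_X = T"
    using mds_code_support_exists[OF mds_code_dual[OF X] T(1,2) nk] by blast
  moreover obtain h_Z where "h_Z \<in> dual_code n C_Z" "vec_supp h_Z = T"
    using mds_code_support_exists[OF mds_code_dual[OF Z] T(1,2) nk] by blast
  ultimately show "\<exists>h_X\<in>dual_code n C_X. \<exists>h_Z\<in>dual_code n C_Z.
      i \<in> vec_supp h_X \<inter> vec_supp h_Z \<and> card (vec_supp h_X \<union> vec_supp h_Z) \<le> k + 1"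
    using T k by (intro bexI[of _ h_X] bexI[of _ h_Z]) auto
qed

lemma mds_code_CSS_EAQLRC:
  assumes X: "mds_code n k (C_X :: 'a::{finite,field} vec set)" and Z: "mds_code n k C_Z"
    and k: "0 < k" "k < n" and c: "c + code_dim n (dual_code n C_X \<inter> C_Z) = n - k"
    and \<kappa>: "\<kappa> + n = 2 * k + c"
  shows "\<exists>Q. CSS_EAQLRC n \<kappa> (n - k + 1) c k C_X C_Z Q \<and> pure_code (n - k + 1) C_X C_Z \<and>
    locally_recoverable n c k Q"
proof -
  note subX = mds_code_subspace[OF X] and subZ = mds_code_subspace[OF Z]
  have dim: "code_dim n C_X = k" "code_dim n C_Z = k"
    using code_dim_eqI[OF subX mds_code_card[OF X]] code_dim_eqI[OF subZ mds_code_card[OF Z]] by auto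
  \<comment> \<open>As both codes have dimension \<open>k\<close>, the two intersections have the
    same dimension.\<close>
  have c': "c + code_dim n (C_X \<inter> dual_code n C_Z) = n - k"
    using code_dim_dual_Int[OF subX subZ] c dim by simp
  then have "n - code_dim n C_Z - code_dim n (C_X \<inter> dual_code n C_Z) = c"
    by (simp add: dim)
  then obtain Q where Q: "EA_CSS_code n c C_X C_Z Q"
    using EA_CSS_code_exists[OF subX subZ] by metis
  have loc: "support_locality n k C_X C_Z"
    by (rule mds_code_support_locality[OF X Z k(2)])
  have "CSS_EAQLRC n \<kappa> (n - k + 1) c k C_X C_Z Q"
    unfolding CSS_EAQLRC_def
    using mds_code_linear_code[OF X k(1)] mds_code_linear_code[OF Z k(1)] loc Q c c' \<kappa> k
      mds_code_EA_CSS_distance[OF X Z k(1)]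
    by (intro exI[of _ k] exI[of _ "n - k + 1"]) auto
  moreover have "pure_code (n - k + 1) C_X C_Z"
    by (simp add: pure_code_def mds_code_min_dist[OF X k(1)] mds_code_min_dist[OF Z k(1)])
  moreover have "locally_recoverable n c k Q"
    by (rule EA_CSS_code_locally_recoverable[OF subX subZ Q loc])
  ultimately show ?thesis
    by blast
qed

section \<open>Monomially equivalent codes\<close>

definition twist :: "nat \<Rightarrow> (nat \<Rightarrow> 'a::times) \<Rightarrow> 'a vec \<Rightarrow> 'a vec" where
  "twist n x u = vec n (\<lambda>i. x i * u $ i)"

text \<open>Kept inside \<open>A\<close>, not as an intersection with the twisted code: it then
  remains meaningful for scalars equal to zero, and words vanishing at a coordinate are unaffected
  by the scalar there.\<close>

definition twist_Int :: "nat \<Rightarrow> 'a::times vec set \<Rightarrow> 'a vec set \<Rightarrow> (nat \<Rightarrow> 'a) \<Rightarrow> 'a vec set" where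
  "twist_Int n A B x = {u \<in> A. twist n x u \<in> B}"

lemma twist_carrier [simp]: "twist n x u \<in> carrier_vec n"
  by (simp add: twist_def)

lemma twist_add:
  fixes u :: "'a::comm_ring_1 vec"
  assumes "u \<in> carrier_vec n" "v \<in> carrier_vec n"
  shows "twist n x (u + v) = twist n x u + twist n x v"
  using assms by (intro eq_vecI) (auto simp: twist_def algebra_simps)

lemma twist_smult:
  fixes u :: "'a::comm_ring_1 vec"
  assumes "u \<in> carrier_vec n"
  shows "twist n x (a \<cdot>\<^sub>v u) = a \<cdot>\<^sub>v twist n x u"
  using assms by (intro eq_vecI) (auto simp: twist_def algebra_simps)

lemma twist_zero: "twist n x (0\<^sub>v n) = (0\<^sub>v n :: 'a::comm_ring_1 vec)"
  by (intro eq_vecI) (auto simp: twist_def)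

lemma twist_cong:
  assumes "\<And>i. i < n \<Longrightarrow> x i * u $ i = y i * u $ i"
  shows "twist n x u = twist n y u"
  using assms by (intro eq_vecI) (auto simp: twist_def)

lemma inj_on_twist:
  fixes x :: "nat \<Rightarrow> 'a::field"
  assumes "\<And>i. i < n \<Longrightarrow> x i \<noteq> 0"
  shows "inj_on (twist n x) (carrier_vec n)"
proof (rule inj_onI)
  fix u v :: "'a vec" assume uv: "u \<in> carrier_vec n" "v \<in> carrier_vec n" and eq: "twist n x u = twist n x v"
  show "u = v"
  proof (rule eq_vecI)
    fix i assume "i < dim_vec v"
    then have "i < n"
      using uv by simp
    then show "u $ i = v $ i"
      using arg_cong[OF eq, of "\<lambda>w. w $ i"] assms by (simp add: twist_def)
  qed (use uv in auto)
qed

lemma subspace_vec_twist: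
  fixes A :: "'a::field vec set"
  assumes A: "subspace_vec n A"
  shows "subspace_vec n (twist n x ` A)"
  unfolding subspace_vec_iff
proof (intro conjI ballI allI)
  note carr = subspace_vec_carrier[OF A]
  show "twist n x ` A \<subseteq> carrier_vec n"
    by auto
  show "0\<^sub>v n \<in> twist n x ` A"
    using twist_zero[of n x] subspace_vec_zero[OF A] by (metis image_eqI)
  fix u v assume "u \<in> twist n x ` A" "v \<in> twist n x ` A"
  then obtain u' v' where *: "u' \<in> A" "v' \<in> A" "u = twist n x u'" "v = twist n x v'"
    by blast
  then show "u + v \<in> twist n x ` A"
    by (intro image_eqI[of _ _ "u' + v'"] subspace_vec_add[OF A])
      (simp_all add: twist_add[OF carr[OF *(1)] carr[OF *(2)]])
next
  fix a u assume "u \<in> twist n x ` A"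
  then obtain u' where *: "u' \<in> A" "u = twist n x u'"
    by blast
  then show "a \<cdot>\<^sub>v u \<in> twist n x ` A"
    by (intro image_eqI[of _ _ "a \<cdot>\<^sub>v u'"] subspace_vec_smult[OF A])
      (simp_all add: twist_smult[OF subspace_vec_carrier[OF A *(1)]])
qed

lemma mds_code_twist:
  fixes A :: "'a::{finite,field} vec set"
  assumes A: "mds_code n k A" and x: "\<And>i. i < n \<Longrightarrow> x i \<noteq> 0"
  shows "mds_code n k (twist n x ` A)"
  unfolding mds_code_def
proof (intro conjI ballI allI impI)
  note sub = mds_code_subspace[OF A]
  show "subspace_vec n (twist n x ` A)"
    by (rule subspace_vec_twist[OF sub])
  show "card (twist n x ` A) = CARD('a) ^ k"
    using card_image[OF inj_on_subset[OF inj_on_twist[OF x] subspace_vec_subset[OF sub]]]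
      mds_code_card[OF A] by simp
  show "k \<le> n"
    by (rule mds_code_le[OF A])
  fix w S assume "w \<in> twist n x ` A" and S: "S \<subseteq> {..<n}" "card S = k" "\<forall>i\<in>S. w $ i = 0"
  then obtain u where u: "u \<in> A" "w = twist n x u"
    by blast
  have "u $ i = 0" if "i \<in> S" for i
  proof -
    have "i < n"
      using that S(1) by auto
    then show ?thesis
      using S(3) that x[of i] by (auto simp: u(2) twist_def)
  qed
  then have "u = 0\<^sub>v n"
    using mds_code_zero[OF A u(1) S(1,2)] by blast
  then show "w = 0\<^sub>v n"
    by (simp add: u(2) twist_zero)
qed

lemma subspace_vec_twist_Int:
  fixes A :: "'a::field vec set"
  assumes A: "subspace_vec n A" and B: "subspace_vec n B"
  shows "subspace_vec n (twist_Int n A B x)"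
  unfolding subspace_vec_iff
proof (intro conjI ballI allI)
  note carr = subspace_vec_carrier[OF A]
  show "twist_Int n A B x \<subseteq> carrier_vec n"
    using subspace_vec_subset[OF A] by (auto simp: twist_Int_def)
  show "0\<^sub>v n \<in> twist_Int n A B x"
    using subspace_vec_zero[OF A] subspace_vec_zero[OF B] by (simp add: twist_Int_def twist_zero)
  fix u v assume "u \<in> twist_Int n A B x" "v \<in> twist_Int n A B x"
  then show "u + v \<in> twist_Int n A B x"
    using subspace_vec_add[OF A] subspace_vec_add[OF B] by (simp add: twist_Int_def twist_add carr)
next
  fix a u assume "u \<in> twist_Int n A B x"
  then show "a \<cdot>\<^sub>v u \<in> twist_Int n A B x"
    using subspace_vec_smult[OF A] subspace_vec_smult[OF B]
    by (simp add: twist_Int_def twist_smult subspace_vec_carrier[OF A])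
qed

lemma card_twist_Int:
  fixes A :: "'a::field vec set"
  assumes A: "subspace_vec n A" and x: "\<And>i. i < n \<Longrightarrow> x i \<noteq> 0"
  shows "card (twist n x ` A \<inter> B) = card (twist_Int n A B x)"
proof -
  have "twist n x ` A \<inter> B = twist n x ` twist_Int n A B x"
    by (auto simp: twist_Int_def)
  moreover have "inj_on (twist n x) (twist_Int n A B x)"
    using inj_on_twist[OF x] by (rule inj_on_subset)
      (use subspace_vec_subset[OF A] in \<open>auto simp: twist_Int_def\<close>)
  ultimately show ?thesis
    by (simp add: card_image)
qed

text \<open>The words with entry 0 at \<open>j\<close> belong to both spaces, and within the first
  one they have index at most \<open>q\<close>.\<close>

lemma card_twist_Int_update:
  fixes A :: "'a::{finite,field} vec set"
  assumes A: "subspace_vec n A" and B: "subspace_vec n B"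
    and xy: "\<And>i. i < n \<Longrightarrow> i \<noteq> j \<Longrightarrow> x i = y i" and j: "j < n"
  shows "card (twist_Int n A B x) \<le> CARD('a) * card (twist_Int n A B y)"
proof -
  let ?K = "twist_Int n A B"
  define K0 where "K0 = {u \<in> ?K x. u $ j = 0}"
  have K: "subspace_vec n (?K x)"
    by (rule subspace_vec_twist_Int[OF A B])
  have "card (?K x) = card ((\<lambda>u. u $ j) ` ?K x) * card K0"
  proof (rule card_fibres[OF K])
    fix u v assume uv: "u \<in> ?K x" "v \<in> ?K x"
    then have "dim_vec v = n"
      using subspace_vec_carrier[OF K] by auto
    then show "u $ j = v $ j \<longleftrightarrow> u - v \<in> K0"
      using subspace_vec_diff[OF K uv] j by (auto simp: K0_def)
  qed (auto simp: K0_def)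
  moreover have "card ((\<lambda>u. u $ j) ` ?K x) \<le> CARD('a)"
    by (rule card_mono) auto
  moreover have "card K0 \<le> card (?K y)"
  proof (rule card_mono)
    show "finite (?K y)"
      using finite_subspace_vec[OF subspace_vec_twist_Int[OF A B]] .
    show "K0 \<subseteq> ?K y"
    proof
      fix u assume u: "u \<in> K0"
      have "twist n x u = twist n y u"
        using u xy by (intro twist_cong) (auto simp: K0_def)
      with u show "u \<in> ?K y"
        by (simp add: K0_def twist_Int_def)
    qed
  qed
  ultimately show ?thesis
    by (simp add: mult_le_mono)
qed

text \<open>Replacing the twist \<open>x\<close> by \<open>y\<close> one coordinate at a time changes the dimension of the
  intersection by at most one in each step, so all intermediate dimensions occur.\<close>

lemma twist_Int_card_between:
  fixes A :: "'a::{finite,field} vec set"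
  assumes A: "subspace_vec n A" and B: "subspace_vec n B"
    and x: "\<And>i. i < n \<Longrightarrow> x i \<noteq> 0" and y: "\<And>i. i < n \<Longrightarrow> y i \<noteq> 0"
    and cx: "CARD('a) ^ l \<le> card (twist_Int n A B x)"
    and cy: "card (twist_Int n A B y) \<le> CARD('a) ^ l"
  shows "\<exists>z. (\<forall>i<n. z i \<noteq> 0) \<and> card (twist_Int n A B z) = CARD('a) ^ l"
proof -
  define z where "z m = (\<lambda>i. if i < m then y i else x i)" for m :: nat
  define e where "e m = code_dim n (twist_Int n A B (z m))" for m
  have card_z: "card (twist_Int n A B (z m)) = CARD('a) ^ e m" for m
    unfolding e_def by (rule card_subspace_vec[OF subspace_vec_twist_Int[OF A B]])
  note q1 = one_less_card_field[where ?'a = 'a]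
  have "z 0 = x"
    by (simp add: z_def)
  then have e0: "l \<le> e 0"
    using cx card_z[of 0] power_increasing_iff[OF q1] by simp
  have "twist_Int n A B (z n) = twist_Int n A B y"
  proof -
    have "twist n (z n) u = twist n y u" for u
      by (rule twist_cong) (simp add: z_def)
    then show ?thesis
      by (simp add: twist_Int_def)
  qed
  then have en: "e n \<le> l"
    using cy card_z[of n] power_increasing_iff[OF q1] by simp
  have step: "e m \<le> Suc (e (Suc m))" if "m < n" for m
  proof -
    have "card (twist_Int n A B (z m)) \<le> CARD('a) * card (twist_Int n A B (z (Suc m)))"
      by (rule card_twist_Int_update[OF A B _ that]) (auto simp: z_def)
    then have "CARD('a) ^ e m \<le> CARD('a) ^ Suc (e (Suc m))"
      by (simp add: card_z)
    then show ?thesis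
      using power_increasing_iff[OF q1] by blast
  qed
  \<comment> \<open>Just before the first index with \<open>e m \<le> l\<close> the value exceeds
    \<open>l\<close>, and one step lowers it by at most one.\<close>
  define m where "m = (LEAST m. e m \<le> l)"
  have m: "e m \<le> l" "m \<le> n"
    using LeastI[of "\<lambda>m. e m \<le> l" n] Least_le[of "\<lambda>m. e m \<le> l" n] en by (auto simp: m_def)
  have "e m = l"
  proof (cases m)
    case 0
    with m e0 show ?thesis
      by simp
  next
    case (Suc m')
    then have "\<not> e m' \<le> l"
      using not_less_Least[of m' "\<lambda>m. e m \<le> l"] by (simp add: m_def)
    then show ?thesis
      using step[of m'] m Suc by simp
  qed
  then show ?thesis
    using card_z[of m] x y by (intro exI[of _ "z m"]) (auto simp: z_def)
qed

text \<open>For the 0-1 twist with support \<open>{..<k}\<close> the intersection is trivial, because a word of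
  \<open>B\<close> vanishing on the other \<open>n - k\<close> coordinates is zero. If two different values of one
  coordinate of the twist both gave a nontrivial intersection, then a combination of the two
  words would show the same for every value of that coordinate; so for at most one value does
  the intersection become nontrivial, and of the at least two nonzero values one is left.\<close>

lemma twist_Int_trivial:
  fixes A :: "'a::{finite,field} vec set"
  assumes A: "mds_code n k A" and B: "mds_code n (n - k) B" and q: "CARD('a) \<ge> 3"
  shows "\<exists>x. (\<forall>i<n. x i \<noteq> 0) \<and> twist_Int n A B x = {0\<^sub>v n}"
proof -
  let ?K = "twist_Int n A B"
  note subA = mds_code_subspace[OF A] and subB = mds_code_subspace[OF B]
  have K: "subspace_vec n (?K x)" for x
    by (rule subspace_vec_twist_Int[OF subA subB])
  have "\<exists>x. (\<forall>i<m. x i \<noteq> 0) \<and> ?K x = {0\<^sub>v n}" if "m \<le> n" for m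
    using that
  proof (induction m)
    case 0
    define x :: "nat \<Rightarrow> 'a" where "x i = (if i < k then 1 else 0)" for i
    have "u = 0\<^sub>v n" if u: "u \<in> ?K x" for u
    proof -
      have uA: "u \<in> A" and uB: "twist n x u \<in> B"
        using u by (auto simp: twist_Int_def)
      have "twist n x u = 0\<^sub>v n"
      proof (rule mds_code_zero[OF B uB, of "{k..<n}"])
        show "twist n x u $ i = 0" if "i \<in> {k..<n}" for i
          using that by (simp add: twist_def x_def)
      qed auto
      then have *: "twist n x u $ i = 0" if "i < n" for i
        using that by simp
      show ?thesis
      proof (rule mds_code_zero[OF A uA, of "{..<k}"])
        show "u $ i = 0" if "i \<in> {..<k}" for i
          using *[of i] that mds_code_le[OF A] by (simp add: twist_def x_def)
      qed (use mds_code_le[OF A] in auto)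
    qed
    then have "?K x = {0\<^sub>v n}"
      using subspace_vec_zero[OF K] by blast
    then show ?case
      by blast
  next
    case (Suc m)
    then obtain x where x: "\<And>i. i < m \<Longrightarrow> x i \<noteq> 0" "?K x = {0\<^sub>v n}"
      by auto
    have m: "m < n"
      using Suc.prems by simp
    have word: "\<exists>u\<in>A. twist n (x(m := s)) u \<in> B \<and> u $ m \<noteq> 0" if "?K (x(m := s)) \<noteq> {0\<^sub>v n}" for s
    proof -
      have "?K (x(m := s)) \<noteq> {}"
        using subspace_vec_zero[OF K] by (rule ex_in_conv[THEN iffD1, OF exI])
      then have "\<not> ?K (x(m := s)) \<subseteq> {0\<^sub>v n}"
        using that by (simp add: subset_singleton_iff)
      then obtain u where u: "u \<in> ?K (x(m := s))" "u \<noteq> 0\<^sub>v n"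
        unfolding subset_iff singleton_iff by metis
      have "u $ m \<noteq> 0"
      proof
        assume "u $ m = 0"
        then have "twist n x u = twist n (x(m := s)) u"
          by (intro twist_cong) auto
        then have "u \<in> ?K x"
          using u(1) by (simp add: twist_Int_def)
        then show False
          using u(2) x(2) by blast
      qed
      with u(1) show ?thesis
        by (auto simp: twist_Int_def)
    qed
    have "\<exists>s. s \<noteq> 0 \<and> ?K (x(m := s)) = {0\<^sub>v n}"
    proof (rule ccontr)
      assume none: "\<not> ?thesis"
      then have nt: "?K (x(m := t)) \<noteq> {0\<^sub>v n}" if "t \<noteq> 0" for t
        using that by blast
      have "\<exists>s::'a. s \<notin> {0, 1}"
      proof (rule ccontr)
        assume "\<not> ?thesis"
        then have "(UNIV :: 'a set) \<subseteq> {0, 1}"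
          by blast
        then have "CARD('a) \<le> card {0, 1 :: 'a}"
          by (intro card_mono) auto
        then show False
          using q by simp
      qed
      then obtain s :: 'a where s: "s \<noteq> 0" "s \<noteq> 1"
        by blast
      obtain u where u: "u \<in> A" "twist n (x(m := s)) u \<in> B" "u $ m \<noteq> 0"
        using word[OF nt[OF s(1)]] by blast
      obtain v where v: "v \<in> A" "twist n (x(m := 1)) v \<in> B" "v $ m \<noteq> 0"
        using word[OF nt[OF one_neq_zero]] by blast
      have un: "dim_vec u = n" and vn: "dim_vec v = n"
        using subspace_vec_carrier[OF subA] u(1) v(1) by auto
      \<comment> \<open>Chosen so that at coordinate \<open>m\<close> the twist by \<open>x\<close>
        agrees with the combination of the two twisted words: with
        \<open>\<alpha> * u $ m = x m - 1\<close> and \<open>\<beta> * v $ m = s - x m\<close>, both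
        are \<open>x m * (s - 1)\<close>. Moreover \<open>w $ m = s - 1\<close> is nonzero,
        contradicting the trivial intersection for \<open>x\<close>.\<close>
      define \<alpha> \<beta> where "\<alpha> = (x m - 1) / u $ m" and "\<beta> = (s - x m) / v $ m"
      define w where "w = \<alpha> \<cdot>\<^sub>v u + \<beta> \<cdot>\<^sub>v v"
      have "w \<in> A"
        unfolding w_def
        by (intro subspace_vec_add[OF subA] subspace_vec_smult[OF subA] u(1) v(1))
      moreover have "twist n x w = \<alpha> \<cdot>\<^sub>v twist n (x(m := s)) u + \<beta> \<cdot>\<^sub>v twist n (x(m := 1)) v"
      proof (rule eq_vecI)
        fix i assume "i < dim_vec (\<alpha> \<cdot>\<^sub>v twist n (x(m := s)) u + \<beta> \<cdot>\<^sub>v twist n (x(m := 1)) v)"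
        then have i: "i < n"
          by (simp add: twist_def)
        have L: "twist n x w $ i = x i * (\<alpha> * u $ i + \<beta> * v $ i)"
          using i un vn by (simp add: twist_def w_def)
        have R: "(\<alpha> \<cdot>\<^sub>v twist n (x(m := s)) u + \<beta> \<cdot>\<^sub>v twist n (x(m := 1)) v) $ i =
            \<alpha> * ((x(m := s)) i * u $ i) + \<beta> * ((x(m := 1)) i * v $ i)"
          using i by (simp add: twist_def)
        show "twist n x w $ i = (\<alpha> \<cdot>\<^sub>v twist n (x(m := s)) u + \<beta> \<cdot>\<^sub>v twist n (x(m := 1)) v) $ i"
        proof (cases "i = m")
          case True
          have eq: "\<alpha> * u $ m = x m - 1" "\<beta> * v $ m = s - x m"
            using u(3) v(3) by (simp_all add: \<alpha>_def \<beta>_def)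
          have "x m * (\<alpha> * u $ m + \<beta> * v $ m) = s * (\<alpha> * u $ m) + \<beta> * v $ m"
            unfolding eq by (simp add: algebra_simps)
          then show ?thesis
            unfolding L R by (simp add: True mult.left_commute)
        next
          case False
          then show ?thesis
            unfolding L R by (simp add: algebra_simps)
        qed
      qed (simp add: twist_def)
      then have "twist n x w \<in> B"
        using subspace_vec_add[OF subB subspace_vec_smult[OF subB u(2)] subspace_vec_smult[OF subB v(2)]]
        by simp
      ultimately have "w = 0\<^sub>v n"
        using x(2) by (auto simp: twist_Int_def)
      then have "w $ m = 0"
        using m by simp
      moreover have "w $ m = s - 1"
        using u(3) v(3) m un vn by (simp add: w_def \<alpha>_def \<beta>_def)
      ultimately show False
        using s by simp
    qed
    then obtain s where s: "s \<noteq> 0" "?K (x(m := s)) = {0\<^sub>v n}"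
      by blast
    have "(x(m := s)) i \<noteq> 0" if "i < Suc m" for i
      using that s(1) x(1)[of i] by (cases "i = m") auto
    with s(2) show ?case
      by blast
  qed
  then show ?thesis
    by blast
qed

section \<open>Extended Reed-Solomon codes\<close>

text \<open>A condition on coefficients instead of the degree, so that the zero polynomial and the
  bound 0 fit in.\<close>

definition polys_below :: "nat \<Rightarrow> 'a::zero poly set" where
  "polys_below k = {f. \<forall>i\<ge>k. coeff f i = 0}"

text \<open>Coordinate \<open>i < q\<close> is the evaluation at the field element \<open>p i\<close>; coordinate \<open>q\<close> is the
  evaluation at infinity.\<close>

definition rs_word :: "(nat \<Rightarrow> 'a) \<Rightarrow> nat \<Rightarrow> nat \<Rightarrow> 'a::{finite,field} poly \<Rightarrow> 'a vec" where
  "rs_word p n k f = vec n (\<lambda>i. if i < CARD('a) then poly f (p i) else coeff f (k - 1))"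

definition rs_code :: "(nat \<Rightarrow> 'a) \<Rightarrow> nat \<Rightarrow> nat \<Rightarrow> 'a::{finite,field} vec set" where
  "rs_code p n k = rs_word p n k ` polys_below k"

lemma polys_below_mono: "k \<le> l \<Longrightarrow> polys_below k \<subseteq> polys_below l"
  by (auto simp: polys_below_def)

lemma bij_betw_polys_below:
  "bij_betw (\<lambda>f. vec k (coeff f)) (polys_below k) (carrier_vec k :: 'a::comm_ring_1 vec set)"
proof (rule bij_betw_byWitness[of _ "\<lambda>v. \<Sum>i<k. monom (v $ i) i"])
  have c: "coeff (\<Sum>i<k. monom (g i) i) j = (if j < k then g j else 0)" for g :: "nat \<Rightarrow> 'a" and j
    by (simp add: coeff_sum)
  show "\<forall>f\<in>polys_below k. (\<Sum>i<k. monom (vec k (coeff f) $ i) i) = (f :: 'a poly)"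
    by (auto simp: poly_eq_iff c polys_below_def)
  show "\<forall>v\<in>carrier_vec k. vec k (coeff (\<Sum>i<k. monom (v $ i) i)) = (v :: 'a vec)"
    by (auto simp: c intro!: eq_vecI)
  show "(\<lambda>f. vec k (coeff f)) ` polys_below k \<subseteq> (carrier_vec k :: 'a vec set)"
    by auto
  show "(\<lambda>v. \<Sum>i<k. monom (v $ i) i) ` (carrier_vec k :: 'a vec set) \<subseteq> polys_below k"
    by (auto simp: polys_below_def c)
qed

lemma card_polys_below: "card (polys_below k :: 'a::{finite,field} poly set) = CARD('a) ^ k"
  using bij_betw_same_card[OF bij_betw_polys_below] card_carrier_vec by metis

lemma polys_below_eq_zero:
  fixes f :: "'a::{finite,field} poly"
  assumes f: "f \<in> polys_below k" and R: "card R \<ge> k" "\<And>x. x \<in> R \<Longrightarrow> poly f x = 0"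
  shows "f = 0"
proof (rule ccontr)
  assume f0: "f \<noteq> 0"
  have "degree f < k"
  proof (rule ccontr)
    assume "\<not> degree f < k"
    then have "lead_coeff f = 0"
      using f by (simp add: polys_below_def)
    with f0 show False
      by simp
  qed
  moreover have "card R \<le> card {x. poly f x = 0}"
    using R(2) by (intro card_mono) auto
  ultimately show False
    using card_poly_roots_bound[OF f0] R(1) by simp
qed

text \<open>A word with \<open>k\<close> zeros comes from a polynomial with \<open>k\<close> roots.
  If one of the zeros is at infinity, only \<open>k - 1\<close> roots remain, but the degree bound
  also drops by one.\<close>

lemma mds_code_rs_code:
  fixes p :: "nat \<Rightarrow> 'a::{finite,field}"
  assumes p: "inj_on p {..<CARD('a)}" and k: "0 < k" "k \<le> n" and n: "n \<le> CARD('a) + 1"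
  shows "mds_code n k (rs_code p n k)" and "inj_on (rs_word p n k) (polys_below k)"
proof -
  let ?q = "CARD('a)" and ?P = "polys_below k :: 'a poly set"
  have zero: "f = 0" if f: "f \<in> ?P" and S: "S \<subseteq> {..<n}" "card S = k"
    and z: "\<And>i. i \<in> S \<Longrightarrow> rs_word p n k f $ i = 0" for f S
  proof -
    have finS: "finite S"
      using S finite_subset by blast
    have root: "poly f x = 0" if "x \<in> p ` (S - {?q})" for x
    proof -
      obtain i where i: "i \<in> S" "i \<noteq> ?q" "x = p i"
        using \<open>x \<in> p ` (S - {?q})\<close> by blast
      have "i < n"
        using i(1) S(1) by auto
      moreover from this have "i < ?q"
        using i(2) n by simp
      ultimately show ?thesis
        using z[OF i(1)] by (simp add: rs_word_def i(3))
    qed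
    have "S - {?q} \<subseteq> {..<?q}"
      using S(1) n by auto
    then have card: "card (p ` (S - {?q})) = card (S - {?q})"
      using card_image inj_on_subset[OF p] by blast
    show ?thesis
    proof (cases "?q \<in> S")
      case True
      then have "coeff f (k - 1) = 0"
        using z[OF True] S(1) by (auto simp: rs_word_def)
      then have "coeff f i = 0" if "i \<ge> k - 1" for i
        using f that by (cases "i = k - 1") (auto simp: polys_below_def)
      then have "f \<in> polys_below (k - 1)"
        by (simp add: polys_below_def)
      moreover have "card (p ` (S - {?q})) = k - 1"
        using True S(2) finS card by simp
      ultimately show ?thesis
        using root polys_below_eq_zero[of f "k - 1" "p ` (S - {?q})"] by simp
    next
      case False
      then show ?thesis
        using root S(2) card polys_below_eq_zero[OF f, of "p ` (S - {?q})"] by simp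
    qed
  qed
  have add: "rs_word p n k (f + g) = rs_word p n k f + rs_word p n k g" for f g
    by (intro eq_vecI) (auto simp: rs_word_def)
  have smult: "rs_word p n k (Polynomial.smult a f) = a \<cdot>\<^sub>v rs_word p n k f" for a f
    by (intro eq_vecI) (auto simp: rs_word_def)
  have diff: "rs_word p n k (f - g) = rs_word p n k f - rs_word p n k g" for f g
    by (intro eq_vecI) (auto simp: rs_word_def)
  have carr: "rs_word p n k f \<in> carrier_vec n" for f
    by (simp add: rs_word_def)
  have zeroP: "rs_word p n k 0 = 0\<^sub>v n"
    by (intro eq_vecI) (auto simp: rs_word_def)
  show inj: "inj_on (rs_word p n k) ?P"
  proof (rule inj_onI)
    fix f g assume fg: "f \<in> ?P" "g \<in> ?P" "rs_word p n k f = rs_word p n k g"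
    have "f - g \<in> ?P"
      using fg by (simp add: polys_below_def)
    moreover have "rs_word p n k (f - g) $ i = 0" if "i \<in> {..<k}" for i
      using that k(2) fg(3) carr[of g] by (simp add: diff)
    ultimately have "f - g = 0"
      using zero[of "f - g" "{..<k}"] k(2) by auto
    then show "f = g"
      by simp
  qed
  show "mds_code n k (rs_code p n k)"
    unfolding mds_code_def
  proof (intro conjI ballI allI impI)
    show "subspace_vec n (rs_code p n k)"
      unfolding subspace_vec_iff rs_code_def
    proof (intro conjI ballI allI)
      show "rs_word p n k ` ?P \<subseteq> carrier_vec n"
        using carr by blast
      show "0\<^sub>v n \<in> rs_word p n k ` ?P"
        using zeroP by (intro image_eqI[of _ _ 0]) (auto simp: polys_below_def)
      fix u v assume "u \<in> rs_word p n k ` ?P" "v \<in> rs_word p n k ` ?P"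
      then obtain f g where "f \<in> ?P" "g \<in> ?P" "u = rs_word p n k f" "v = rs_word p n k g"
        by blast
      then show "u + v \<in> rs_word p n k ` ?P"
        by (intro image_eqI[of _ _ "f + g"]) (auto simp: add polys_below_def)
    next
      fix a u assume "u \<in> rs_word p n k ` ?P"
      then obtain f where "f \<in> ?P" "u = rs_word p n k f"
        by blast
      then show "a \<cdot>\<^sub>v u \<in> rs_word p n k ` ?P"
        by (intro image_eqI[of _ _ "Polynomial.smult a f"]) (auto simp: smult polys_below_def)
    qed
    show "card (rs_code p n k) = ?q ^ k"
      using card_image[OF inj] card_polys_below by (simp add: rs_code_def)
    show "k \<le> n"
      by (rule k(2))
    fix x S assume x: "x \<in> rs_code p n k" and S: "S \<subseteq> {..<n}" "card S = k" "\<forall>i\<in>S. x $ i = 0"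
    obtain f where f: "f \<in> ?P" "x = rs_word p n k f"
      using x by (auto simp: rs_code_def)
    then have "f = 0"
      using zero[of f S] S by blast
    then show "x = 0\<^sub>v n"
      using f(2) zeroP by simp
  qed
qed

text \<open>For \<open>m \<ge> 2\<close> the polynomial \<open>X^m - X^(m-1)\<close> takes the value
  0 at both 0 and 1. A non-injective self-map of a finite set misses some value; subtracting that
  value removes all roots.\<close>

lemma rootless_poly_exists:
  assumes "m \<ge> 2"
  shows "\<exists>h::'a::{finite,field} poly. h \<in> polys_below (Suc m) \<and> coeff h m = 1 \<and> (\<forall>x. poly h x \<noteq> 0)"
proof -
  define g :: "'a poly" where "g = monom 1 m - monom 1 (m - 1)"
  have g01: "poly g 0 = poly g 1"
    using assms by (simp add: g_def poly_monom power_0_left)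
  have "\<not> inj (poly g)"
    using injD[of "poly g" 0 1] g01 by (metis zero_neq_one)
  then have "\<not> surj (poly g)"
    using finite_UNIV_surj_inj[of "poly g"] by auto
  then obtain e where e: "\<And>x. e \<noteq> poly g x"
    by (auto simp: surj_def)
  have "coeff (g - [:e:]) m = 1"
    using assms by (auto simp: g_def coeff_pCons split: nat.split)
  moreover have "g - [:e:] \<in> polys_below (Suc m)"
    using assms by (auto simp: g_def polys_below_def coeff_pCons split: nat.split)
  moreover have "poly (g - [:e:]) x \<noteq> 0" for x
    using e[of x] by auto
  ultimately show ?thesis
    by blast
qed

text \<open>Evaluation at infinity is multiplicative with respect to the formal degree bounds
  \<open>a\<close> and \<open>b\<close>, even where the actual degrees are smaller.\<close>

lemma coeff_mult_below:
  fixes f g :: "'a::comm_ring_1 poly"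
  assumes f: "f \<in> polys_below (Suc a)" and g: "g \<in> polys_below (Suc b)"
  shows "f * g \<in> polys_below (Suc (a + b))" and "coeff (f * g) (a + b) = coeff f a * coeff g b"
proof -
  have zero: "coeff f i * coeff g (m - i) = 0" if "i \<le> m" "a + b \<le> m" "i \<noteq> a \<or> m \<noteq> a + b" for i m
  proof (cases "i \<le> a")
    case True
    then have "Suc b \<le> m - i"
      using that by auto
    then show ?thesis
      using g by (simp add: polys_below_def)
  next
    case False
    then show ?thesis
      using f by (simp add: polys_below_def)
  qed
  show "f * g \<in> polys_below (Suc (a + b))"
    using zero by (auto simp: polys_below_def coeff_mult intro!: sum.neutral)
  have "coeff (f * g) (a + b) = (\<Sum>i\<le>a + b. if i = a then coeff f a * coeff g b else 0)"
    unfolding coeff_mult using zero[of _ "a + b"] by (intro sum.cong) auto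
  then show "coeff (f * g) (a + b) = coeff f a * coeff g b"
    by simp
qed

text \<open>If the point at infinity does not occur or \<open>l < min a b\<close>, then the polynomials of degree
  less than \<open>l\<close> have the same words in both codes. Otherwise multiply the polynomials of the
  smaller code by a monic polynomial of degree \<open>b - a\<close> without roots; there is none for
  \<open>b = a + 1\<close>.\<close>

lemma rs_code_twist_Int_large:
  fixes p :: "nat \<Rightarrow> 'a::{finite,field}"
  assumes p: "inj_on p {..<CARD('a)}" and a: "0 < a" "a \<le> n" and n: "n \<le> CARD('a) + 1"
    and l: "l \<le> a" "l < b" and side: "n \<le> CARD('a) \<or> l < a \<or> a + 2 \<le> b"
  shows "\<exists>x. (\<forall>i<n. x i \<noteq> 0) \<and> CARD('a) ^ l \<le> card (twist_Int n (rs_code p n a) (rs_code p n b) x)"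
proof -
  let ?q = "CARD('a)" and ?P = "polys_below :: nat \<Rightarrow> 'a poly set"
  note inj = mds_code_rs_code(2)[OF p a n]
  have fin: "finite (rs_code p n a)"
    using finite_subspace_vec[OF mds_code_subspace[OF mds_code_rs_code(1)[OF p a n]]] .
  have "\<exists>x. (\<forall>i<n. x i \<noteq> 0) \<and> rs_word p n a ` ?P l \<subseteq> twist_Int n (rs_code p n a) (rs_code p n b) x"
  proof (cases "n \<le> ?q \<or> l < a")
    case True
    have "twist n (\<lambda>_. 1) (rs_word p n a f) = rs_word p n b f" if "f \<in> ?P l" for f
    proof -
      \<comment> \<open>An index \<open>i \<ge> q\<close> forces \<open>n > q\<close> and hence
        \<open>l < a\<close> in this case; both coefficients then lie beyond the degree bound of
        \<open>f\<close> and are 0.\<close>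
      have "coeff f (a - 1) = coeff f (b - 1)" if "i < n" "\<not> i < ?q" for i
      proof -
        have "l \<le> a - 1" "l \<le> b - 1"
          using that True n l by auto
        then show ?thesis
          using \<open>f \<in> ?P l\<close> by (simp add: polys_below_def)
      qed
      then show ?thesis
        by (intro eq_vecI) (auto simp: twist_def rs_word_def)
    qed
    moreover have "?P l \<subseteq> ?P a" "?P l \<subseteq> ?P b"
      using l by (auto intro!: polys_below_mono)
    ultimately have "rs_word p n a ` ?P l \<subseteq> twist_Int n (rs_code p n a) (rs_code p n b) (\<lambda>_. 1)"
      by (auto simp: twist_Int_def rs_code_def)
    then show ?thesis
      by (intro exI[of _ "\<lambda>_. 1"]) simp
  next
    case False
    with side l have ab: "l = a" "a + 2 \<le> b"
      by auto
    have "2 \<le> b - a"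
      using ab(2) by simp
    then obtain h :: "'a poly" where h: "h \<in> ?P (Suc (b - a))" "coeff h (b - a) = 1" "\<And>x. poly h x \<noteq> 0"
      using rootless_poly_exists[of "b - a", where ?'a = 'a] by blast
    \<comment> \<open>The values of \<open>h\<close> at all points, where the value at infinity is
      the leading coefficient 1.\<close>
    define x where "x i = (if i < ?q then poly h (p i) else 1)" for i
    have "twist n x (rs_word p n a f) \<in> rs_code p n b" if f: "f \<in> ?P a" for f
    proof -
      have "f \<in> ?P (Suc (a - 1))"
        using f a by simp
      note fh = coeff_mult_below[OF this h(1)]
      have "f * h \<in> ?P b"
        using fh(1) a ab by simp
      moreover have "coeff (f * h) (b - 1) = coeff f (a - 1)"
        using fh(2) a ab h(2) by simp
      then have "twist n x (rs_word p n a f) = rs_word p n b (f * h)"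
        by (intro eq_vecI) (auto simp: twist_def rs_word_def x_def)
      ultimately show ?thesis
        by (simp add: rs_code_def)
    qed
    then have "rs_word p n a ` ?P l \<subseteq> twist_Int n (rs_code p n a) (rs_code p n b) x"
      by (auto simp: twist_Int_def rs_code_def ab(1))
    moreover have "x i \<noteq> 0" for i
      using h(3) by (simp add: x_def)
    ultimately show ?thesis
      by blast
  qed
  then obtain x where x: "\<forall>i<n. x i \<noteq> 0"
    "rs_word p n a ` ?P l \<subseteq> twist_Int n (rs_code p n a) (rs_code p n b) x"
    by blast
  have "card (rs_word p n a ` ?P l) = ?q ^ l"
    using card_image[OF inj_on_subset[OF inj polys_below_mono[OF l(1)]]] card_polys_below by metis
  moreover have "finite (twist_Int n (rs_code p n a) (rs_code p n b) x)"
    using fin by (simp add: twist_Int_def)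
  ultimately have "?q ^ l \<le> card (twist_Int n (rs_code p n a) (rs_code p n b) x)"
    using card_mono[OF _ x(2)] by metis
  with x(1) show ?thesis
    by blast
qed

section \<open>Pairs of MDS codes with prescribed intersection, and the parameters\<close>

lemma mds_code_pair_exists:
  assumes q: "CARD('a::{finite,field}) \<ge> 3" and a: "0 < a" "a < n" and n: "n \<le> CARD('a) + 1"
    and l: "l \<le> a" "l < n - a" and side: "n \<le> CARD('a) \<or> l < a \<or> a + 2 \<le> n - a"
  shows "\<exists>A B :: 'a vec set. mds_code n a A \<and> mds_code n (n - a) B \<and> code_dim n (A \<inter> B) = l"
proof -
  obtain p :: "nat \<Rightarrow> 'a" where "bij_betw p {0..<CARD('a)} UNIV"
    using ex_bij_betw_nat_finite[OF finite, of "UNIV :: 'a set"] by blast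
  then have p: "inj_on p {..<CARD('a)}"
    by (simp add: bij_betw_def atLeast0LessThan)
  define A B where "A = rs_code p n a" and "B = rs_code p n (n - a)"
  have A: "mds_code n a A"
    unfolding A_def using a by (intro mds_code_rs_code(1)[OF p _ _ n]) auto
  have B: "mds_code n (n - a) B"
    unfolding B_def using a by (intro mds_code_rs_code(1)[OF p _ _ n]) auto
  note subA = mds_code_subspace[OF A] and subB = mds_code_subspace[OF B]
  obtain x where x: "\<forall>i<n. x i \<noteq> 0" "CARD('a) ^ l \<le> card (twist_Int n A B x)"
    using rs_code_twist_Int_large[OF p a(1) _ n l side] a by (auto simp: A_def B_def)
  obtain y where y: "\<forall>i<n. y i \<noteq> 0" "twist_Int n A B y = {0\<^sub>v n}"
    using twist_Int_trivial[OF A B q] by blast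
  have "card (twist_Int n A B y) \<le> CARD('a) ^ l"
    by (simp add: y(2))
  then obtain z where z: "\<forall>i<n. z i \<noteq> 0" "card (twist_Int n A B z) = CARD('a) ^ l"
    using twist_Int_card_between[OF subA subB _ _ x(2)] x(1) y(1) by blast
  have zA: "mds_code n a (twist n z ` A)"
    using z(1) by (intro mds_code_twist[OF A]) simp
  have "card (twist n z ` A \<inter> B) = CARD('a) ^ l"
    using card_twist_Int[OF subA] z by simp
  then have "code_dim n (twist n z ` A \<inter> B) = l"
    by (rule code_dim_eqI[OF subspace_vec_Int[OF mds_code_subspace[OF zA] subB]])
  with zA B show ?thesis
    by blast
qed

theorem theorem6:
  fixes q n d c :: nat
  assumes q: "q = CARD('a::{finite,field})" "q \<ge> 3"
    and d: "2 \<le> d" "d \<le> n" "n \<le> q + 1"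
    and c: "max 0 (2 * int d - int n - 1) \<le> int c" "c \<le> d - 1"
    and ndc: "(n, d, c) \<notin> {(q + 1, 2, 1), (q + 1, q + 1, q)}"
    and ndc_even: "even q \<Longrightarrow> (n, d, c) \<noteq> (q + 1, q div 2 + 1, 0)"
  shows "\<exists>(C_X :: 'a vec set) (C_Z :: 'a vec set) (Q :: ('a label \<Rightarrow> complex) set).
           CSS_EAQLRC n (n + c + 2 - 2 * d) d c (n - d + 1) C_X C_Z Q \<and>
           pure_code d C_X C_Z \<and>
           locally_recoverable n c (n - d + 1) Q \<and>
           singleton_optimal n (n + c + 2 - 2 * d) d c (n - d + 1)"
proof -
  define a l k \<kappa> where "a = d - 1" and "l = d - 1 - c" and "k = n - d + 1"
    and "\<kappa> = n + c + 2 - 2 * d"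
  have c': "2 * d \<le> n + c + 1"
    using c(1) by simp
  have a: "0 < a" "a < n" "n - a = k"
    using d by (auto simp: a_def k_def)
  \<comment> \<open>The second inequality is the positivity of \<kappa>, that is, the lower bound
    \<open>2 * d - n - 1\<close> on \<open>c\<close>.\<close>
  have l: "l \<le> a" "l < n - a"
    using d c c' by (auto simp: l_def a_def)
  \<comment> \<open>Here \<open>n = q + 1\<close> and \<open>c = 0\<close>. As
    \<open>l = a < n - a\<close>, failure leaves only \<open>n - a = a + 1\<close>, so
    \<open>q = 2 * d - 2\<close> is even and the triple is the excluded one.\<close>
  have "a + 2 \<le> n - a" if "\<not> n \<le> q" "\<not> l < a"
  proof (rule ccontr)
    assume *: "\<not> ?thesis"
    have "n = q + 1" "c = 0"
      using that d c(2) by (auto simp: l_def a_def)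
    moreover from this have "q + 2 = 2 * d"
      using * l that d c' by (auto simp: a_def)
    ultimately show False
      using ndc_even by (metis Suc_1 add.commute add_Suc_right even_add even_mult_iff
          even_numeral nonzero_mult_div_cancel_left div_add_self2 plus_1_eq_Suc zero_neq_numeral)
  qed
  then have side: "n \<le> CARD('a) \<or> l < a \<or> a + 2 \<le> n - a"
    using q(1) by blast
  obtain A B :: "'a vec set" where A: "mds_code n a A" and B: "mds_code n k B"
    and AB: "code_dim n (A \<inter> B) = l"
    using mds_code_pair_exists[OF _ a(1,2) _ l side] q d(3) a(3) by auto
  have X: "mds_code n k (dual_code n A)"
    using mds_code_dual[OF A] a(3) by simp
  have dd: "dual_code n (dual_code n A) = A"
    by (rule dual_dual[OF mds_code_subspace[OF A]])
  have "c + code_dim n (dual_code n (dual_code n A) \<inter> B) = n - k"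
    using c(2) d by (simp add: dd AB l_def k_def)
  moreover have "\<kappa> + n = 2 * k + c" "0 < k" "k < n" "n - k + 1 = d"
    using c' d by (auto simp: \<kappa>_def k_def)
  ultimately obtain Q where Q: "CSS_EAQLRC n \<kappa> d c k (dual_code n A) B Q"
    "pure_code d (dual_code n A) B" "locally_recoverable n c k Q"
    using mds_code_CSS_EAQLRC[OF X B] by metis
  have "singleton_optimal n \<kappa> d c k"
  proof -
    \<comment> \<open>Since \<kappa> equals \<open>k - l\<close> and \<open>r = k\<close>, the
      rounded quotient is 1.\<close>
    have "0 < \<kappa>" "\<kappa> \<le> k"
      using c' c(2) d by (auto simp: \<kappa>_def k_def)
    then have "\<lceil>real \<kappa> / real k\<rceil> = 1"
      by (intro ceiling_unique) auto
    moreover have "int \<kappa> = int n + int c + 2 - 2 * int d"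
      using c' by (simp add: \<kappa>_def)
    ultimately show ?thesis
      by (simp add: singleton_optimal_def)
  qed
  with Q show ?thesis
    unfolding \<kappa>_def k_def by blast
qed

end
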